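(* Let $D$ be the Drinfeld double of $\mathcal{FK}_3\#\Bbbk\mathbb{S}_3$ and let $E$ be a $D$-module fitting into a short exact sequence of $D$-modules $0\to L(\mu)\to E\to L(\lambda)\to0$. If $\lambda,\mu\in\{\varepsilon,(e,\rho),(\tau,0)\}$ or $\lambda=\mu=(\sigma,-)$, then $E\simeq L(\mu)\oplus L(\lambda)$.
   Context: Let $\Bbbk$ be an algebraically closed field of characteristic zero and $\zeta\in\Bbbk$ a primitive cube root of unity. All modules are finite-dimensional left modules. The algebra. $D(\mathbb{S}_3)$ is the Drinfeld double of the group algebra $\Bbbk\mathbb{S}_3$: it is generated by $g\in\mathbb{S}_3$ and the dual basis elements $\delta_g$ of $\Bbbk^{\mathbb{S}_3}$, with $g\delta_hg^{-1}=\delta_{ghg^{-1}}$. A $D(\mathbb{S}_3)$-module is an $\mathbb{S}_3$-module with a compatible $\mathbb{S}_3$-grading, $\delta_g$ being the projection to the component of $\mathbb{S}_3$-degree $g$. Let $V=\Bbbk\{x_{(12)},x_{(13)},x_{(23)}\}$ be the simple $D(\mathbb{S}_3)$-module with $g\cdot x_{(ij)}=\mathrm{sgn}(g)x_{g(ij)g^{-1}}$ and $\delta_g\cdot x_{(ij)}=\delta_{g,(ij)}x_{(ij)}$; let $\overline V=\Bbbk\{y_{(12)},y_{(13)},y_{(23)}\}$ be its dual, isomorphic to $V$ via $y_{(ij)}\mapsto x_{(ij)}$. The Nichols algebra $\mathfrak{B}(V)=\mathcal{FK}_3$ is the quotient of $T(V)$ by $x_{(ij)}^2$, $x_{(12)}x_{(13)}+x_{(23)}x_{(12)}+x_{(13)}x_{(23)}$,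 $x_{(13)}x_{(12)}+x_{(12)}x_{(23)}+x_{(23)}x_{(13)}$ (dimension 12); $\mathfrak{B}(\overline V)$ is the same algebra in the $y$'s. $D$ is the Drinfeld double of the bosonization $\mathcal{FK}_3\#\Bbbk\mathbb{S}_3$. It is generated by $D(\mathbb{S}_3)$, $V$, $\overline V$; multiplication gives a linear isomorphism $\mathfrak{B}(V)\otimes D(\mathbb{S}_3)\otimes\mathfrak{B}(\overline V)\to D$. Its Hopf subalgebras $D^{\le0}=\mathfrak{B}(V)\#D(\mathbb{S}_3)$ and $D^{\ge0}=\mathfrak{B}(\overline V)\#D(\mathbb{S}_3)$ are bosonizations, so $gx_{(ij)}g^{-1}=\mathrm{sgn}(g)x_{g(ij)g^{-1}}$, $\delta_gx_{(ij)}=x_{(ij)}\delta_{(ij)g}$ and likewise for the $y$'s; the cross relations are $y_sx_r=-x_ry_{rsr}+\delta_{s,r}1+r(\delta_s-\delta_{sr})$ for transpositions $s,r$. $D$ is $\mathbb{Z}$-graded with $\deg V=-1$, $\deg D(\mathbb{S}_3)=0$, $\deg\overline V=1$. Weights. The weights are the simple $D(\mathbb{S}_3)$-modules, indexed by $\Lambda=\{\varepsilon=(e,+),(e,-),(e,\rho),(\sigma,+),(\sigma,-),(\tau,0),(\tau,1),(\tau,2)\}$. Here $(e,+),(e,-),(e,\rho)$ have $\mathbb{S}_3$-degree $e$ and carry the trivial, sign and 2-dimensional irreducible representation; $(\sigma,\pm)$ has basis $|12\rangle,|13\rangle,|23\rangle$ with $|ij\rangle=|ji\rangle$ of degree $(ij)$,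 $g|ij\rangle=|g(i)g(j)\rangle$ for $(\sigma,+)$ and $g|ij\rangle=\mathrm{sgn}(g)|g(i)g(j)\rangle$ for $(\sigma,-)$; $(\tau,\ell)$ has basis $|123\rangle_\ell,|132\rangle_\ell$ of degrees $(123),(132)$, where $(12)$ swaps the two basis vectors and $(123)$ acts by $\zeta^\ell$ on $|123\rangle_\ell$ and by $\zeta^{-\ell}$ on $|132\rangle_\ell$. Simple modules. $L(\lambda)$, $\lambda\in\Lambda$, is the unique simple $D$-module of highest weight $\lambda$, i.e. containing a $D(\mathbb{S}_3)$-submodule isomorphic to $\lambda$ killed by $\overline V$; it is the head of $D\otimes_{D^{\ge0}}\lambda$ ($\overline V$ acting by zero on $\lambda$). *)

theory Defs
  imports
    "HOL-Library.Numeral_Type"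
    "HOL-Library.Poly_Mapping"
    "HOL-Computational_Algebra.Polynomial"
    "HOL-Combinatorics.Perm"
    "HOL-Combinatorics.Permutations"
    "HOL-Analysis.Product_Vector"
begin

section \<open>The symmetric group on three letters\<close>

text \<open>
  The three letters are the elements \<open>1, 2, 3\<close> of the three-element type \<open>3\<close> (where \<open>3 = 0\<close>).
  Products of permutations are compositions, so \<open>(g * h) i = g (h i)\<close>, and
  \<open>cycle [1,2,3]\<close> maps \<open>1\<close> to \<open>2\<close>, \<open>2\<close> to \<open>3\<close> and \<open>3\<close> to \<open>1\<close>.
\<close>

type_synonym S3 = "3 perm"

abbreviation c123 :: S3 where "c123 \<equiv> cycle [1, 2, 3]"
abbreviation c132 :: S3 where "c132 \<equiv> cycle [1, 3, 2]"

definition sgn3 :: "S3 \<Rightarrow> 'k::ring_1" where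
  "sgn3 g = of_int (sign (Perm.apply g))"

lemma finite_UNIV_S3: "finite (UNIV :: S3 set)"
proof -
  have "range (Perm.apply :: S3 \<Rightarrow> 3 \<Rightarrow> 3) \<subseteq> UNIV" by simp
  hence "finite (range (Perm.apply :: S3 \<Rightarrow> 3 \<Rightarrow> 3))" by (rule finite_subset) simp
  thus ?thesis by (rule finite_imageD) (auto simp: inj_on_def intro: perm_eqI)
qed

datatype transposition = T12 | T13 | T23

primrec perm_of :: "transposition \<Rightarrow> S3" where
  "perm_of T12 = Perm.swap 1 2"
| "perm_of T13 = Perm.swap 1 3"
| "perm_of T23 = Perm.swap 2 3"

definition conjt :: "S3 \<Rightarrow> transposition \<Rightarrow> transposition" where
  "conjt g r = inv perm_of (g * perm_of r * inverse g)"

lemma letters_distinct: "(1::3) \<noteq> 2" "(1::3) \<noteq> 3" "(2::3) \<noteq> 3"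
  by simp_all

lemma letters_exhaust: "(a::3) = 1 \<or> a = 2 \<or> a = 3"
proof (cases a)
  case (of_int z)
  then have "z = 0 \<or> z = 1 \<or> z = 2" by auto
  with of_int show ?thesis by auto
qed

lemma inj_perm_of: "inj perm_of"
proof (rule injI)
  fix r s assume eq: "perm_of r = perm_of s"
  have "Perm.apply (perm_of r) i = Perm.apply (perm_of s) i" for i by (simp add: eq)
  from this[of 1] this[of 2] this[of 3] show "r = s"
    by (cases r; cases s; simp)
qed

lemma perm_of_conjt: "perm_of (conjt g r) = g * perm_of r * inverse g"
proof -
  have swap_conj: "g * Perm.swap a b * inverse g
      = Perm.swap (Perm.apply g a) (Perm.apply g b)" for a b
  proof (rule perm_eqI)
    fix c
    obtain d where c: "c = Perm.apply g d"
      using bij_is_surj[OF bij_apply[of g]] by (rule surjE)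
    have inv: "Perm.apply (inverse g) (Perm.apply g e) = e" for e by (simp add: apply_sequence)
    show "Perm.apply (g * Perm.swap a b * inverse g) c
        = Perm.apply (Perm.swap (Perm.apply g a) (Perm.apply g b)) c"
      by (cases "d = a"; cases "d = b")
        (simp_all add: c apply_times inv apply_inj)
  qed
  have swap_range: "Perm.swap a b \<in> range perm_of" if "a \<noteq> b" for a b :: 3
  proof -
    have "Perm.swap 1 2 \<in> range perm_of" "Perm.swap 1 3 \<in> range perm_of" "Perm.swap 2 3 \<in> range perm_of"
      using rangeI[of perm_of T12] rangeI[of perm_of T13] rangeI[of perm_of T23]
      by (simp_all only: perm_of.simps)
    moreover from this have
      "Perm.swap 2 1 \<in> range perm_of" "Perm.swap 3 1 \<in> range perm_of" "Perm.swap 3 2 \<in> range perm_of"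
      by (simp_all only: swap_sym[of "2::3" 1] swap_sym[of "3::3" 1] swap_sym[of "3::3" 2])
    ultimately show ?thesis
      using letters_exhaust[of a] letters_exhaust[of b] that by metis
  qed
  have neq: "Perm.apply g a \<noteq> Perm.apply g b" if "a \<noteq> b" for a b
    using that by (simp add: apply_inj)
  have "g * perm_of r * inverse g \<in> range perm_of"
  proof (cases r)
    case T12
    show ?thesis unfolding T12 perm_of.simps swap_conj
      by (intro swap_range neq letters_distinct)
  next
    case T13
    show ?thesis unfolding T13 perm_of.simps swap_conj
      by (intro swap_range neq letters_distinct)
  next
    case T23
    show ?thesis unfolding T23 perm_of.simps swap_conj
      by (intro swap_range neq letters_distinct)
  qed
  thus ?thesis unfolding conjt_def by (rule f_inv_into_f)
qed


section \<open>The free algebra on the generators\<close>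

text \<open>The generators of the double: \<open>g\<close>, \<open>\<delta>\<^sub>g\<close> for \<open>g \<in> S\<^sub>3\<close>, and \<open>x\<^sub>r\<close>, \<open>y\<^sub>r\<close> for transpositions \<open>r\<close>.\<close>

datatype gen = Grp S3 | Dlt S3 | X transposition | Y transposition

text \<open>
  Words under concatenation, written additively: finitely supported functions on an additive monoid
  carry the convolution product, so \<open>gen word \<Rightarrow>\<^sub>0 'k\<close> is the free associative algebra.
\<close>

datatype 'a word = Word (letters: "'a list")

instantiation word :: (type) monoid_add
begin
definition "0 = Word []"
definition "v + w = Word (letters v @ letters w)"
instance by standard (simp_all add: zero_word_def plus_word_def)
end

type_synonym 'k free_alg = "gen word \<Rightarrow>\<^sub>0 'k"

definition gen :: "gen \<Rightarrow> 'k::field free_alg" where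
  "gen z = Poly_Mapping.single (Word [z]) 1"

definition const :: "'k::field \<Rightarrow> 'k free_alg" where
  "const c = Poly_Mapping.single 0 c"


section \<open>The double of the bosonization of the Fomin-Kirillov algebra\<close>

text \<open>
  The double is presented by the relations of \<open>D(S\<^sub>3)\<close>, those of the Nichols algebra for the \<open>x\<close> and
  for the \<open>y\<close>, those of the two bosonizations, and the cross relations.  A difference \<open>a - b\<close> below
  stands for the relation \<open>a = b\<close>.  The relations common to the \<open>x\<close> and the \<open>y\<close> are stated
  once, for \<open>z \<in> {X, Y}\<close>.
\<close>

inductive_set relators :: "'k::field free_alg set" where
  grp_one:  "gen (Grp 1) - 1 \<in> relators"
| grp_mult: "gen (Grp g) * gen (Grp h) - gen (Grp (g * h)) \<in> relators"
| dlt_mult: "gen (Dlt g) * gen (Dlt h) - (if g = h then gen (Dlt g) else 0) \<in> relators"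
| dlt_sum:  "(\<Sum>g\<in>UNIV. gen (Dlt g)) - 1 \<in> relators"
| grp_dlt:  "gen (Grp g) * gen (Dlt h) * gen (Grp (inverse g)) - gen (Dlt (g * h * inverse g)) \<in> relators"
| nichols_square: "z \<in> {X, Y} \<Longrightarrow> gen (z r) * gen (z r) \<in> relators"
| nichols_1: "z \<in> {X, Y} \<Longrightarrow>
    gen (z T12) * gen (z T13) + gen (z T23) * gen (z T12) + gen (z T13) * gen (z T23) \<in> relators"
| nichols_2: "z \<in> {X, Y} \<Longrightarrow>
    gen (z T13) * gen (z T12) + gen (z T12) * gen (z T23) + gen (z T23) * gen (z T13) \<in> relators"
| grp_boson: "z \<in> {X, Y} \<Longrightarrow>
    gen (Grp g) * gen (z r) * gen (Grp (inverse g)) - const (sgn3 g) * gen (z (conjt g r)) \<in> relators"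
| dlt_boson: "z \<in> {X, Y} \<Longrightarrow>
    gen (Dlt g) * gen (z r) - gen (z r) * gen (Dlt (perm_of r * g)) \<in> relators"
| cross:
    "gen (Y s) * gen (X r)
       - (- (gen (X r) * gen (Y (conjt (perm_of r) s)))
          + (if s = r then 1 else 0)
          + gen (Grp (perm_of r)) * (gen (Dlt (perm_of s)) - gen (Dlt (perm_of s * perm_of r))))
     \<in> relators"

inductive_set rel_ideal :: "'k::field free_alg set" where
  zero: "0 \<in> rel_ideal"
| base: "r \<in> relators \<Longrightarrow> a * r * b \<in> rel_ideal"
| add:  "u \<in> rel_ideal \<Longrightarrow> v \<in> rel_ideal \<Longrightarrow> u + v \<in> rel_ideal"

lemma rel_ideal_lmult: "u \<in> rel_ideal \<Longrightarrow> a * u \<in> rel_ideal"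
proof (induction rule: rel_ideal.induct)
  case (base r p q)
  then show ?case using rel_ideal.base[of r "a * p" q] by (simp add: mult.assoc)
qed (auto simp: distrib_left intro: rel_ideal.intros)

lemma rel_ideal_rmult: "u \<in> rel_ideal \<Longrightarrow> u * a \<in> rel_ideal"
proof (induction rule: rel_ideal.induct)
  case (base r p q)
  then show ?case using rel_ideal.base[of r p "q * a"] by (simp add: mult.assoc)
qed (auto simp: distrib_right intro: rel_ideal.intros)

lemma rel_ideal_uminus: "u \<in> rel_ideal \<Longrightarrow> - u \<in> rel_ideal"
  using rel_ideal_lmult[of u "- 1"] by simp

lemma rel_ideal_diff: "u \<in> rel_ideal \<Longrightarrow> v \<in> rel_ideal \<Longrightarrow> u - v \<in> rel_ideal"
  using rel_ideal.add[of u "- v"] rel_ideal_uminus[of v] by simp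

definition rel_cong :: "'k::field free_alg \<Rightarrow> 'k free_alg \<Rightarrow> bool" where
  "rel_cong a b \<longleftrightarrow> a - b \<in> rel_ideal"

lemma equivp_rel_cong: "equivp (rel_cong :: 'k::field free_alg \<Rightarrow> _)"
proof (rule equivpI)
  show "reflp (rel_cong :: 'k free_alg \<Rightarrow> _)" by (rule reflpI) (simp add: rel_cong_def rel_ideal.zero)
  show "symp (rel_cong :: 'k free_alg \<Rightarrow> _)"
  proof (rule sympI)
    fix a b :: "'k free_alg"
    assume "rel_cong a b"
    thus "rel_cong b a" using rel_ideal_uminus[of "a - b"] by (simp add: rel_cong_def)
  qed
  show "transp (rel_cong :: 'k free_alg \<Rightarrow> _)"
  proof (rule transpI)
    fix a b c :: "'k free_alg"
    assume "rel_cong a b" "rel_cong b c"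
    thus "rel_cong a c" using rel_ideal.add[of "a - b" "b - c"] by (simp add: rel_cong_def)
  qed
qed

quotient_type (overloaded) 'k double = "'k::field free_alg" / rel_cong
  by (rule equivp_rel_cong)


subsection \<open>The counit; in particular the presented algebra is nonzero\<close>

primrec counit_gen :: "gen \<Rightarrow> 'k::field" where
  "counit_gen (Grp g) = 1"
| "counit_gen (Dlt g) = (if g = 1 then 1 else 0)"
| "counit_gen (X r) = 0"
| "counit_gen (Y r) = 0"

definition counit_word :: "gen word \<Rightarrow> 'k::field" where
  "counit_word w = prod_list (map counit_gen (letters w))"

definition counit :: "'k::field free_alg \<Rightarrow> 'k" where
  "counit f = (\<Sum>w\<in>Poly_Mapping.keys f. Poly_Mapping.lookup f w * counit_word w)"

lemma counit_superset:
  "finite A \<Longrightarrow> Poly_Mapping.keys f \<subseteq> A \<Longrightarrow>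
    counit f = (\<Sum>w\<in>A. Poly_Mapping.lookup f w * counit_word w)"
  unfolding counit_def by (rule sum.mono_neutral_left) (auto simp: in_keys_iff)

lemma counit_add: "counit (f + g) = counit f + counit g"
proof -
  let ?A = "Poly_Mapping.keys f \<union> Poly_Mapping.keys g"
  have "counit (f + g) = (\<Sum>w\<in>?A. Poly_Mapping.lookup (f + g) w * counit_word w)"
    by (rule counit_superset) (auto simp: Poly_Mapping.keys_add)
  also have "\<dots> = counit f + counit g"
    by (simp add: counit_superset[of ?A f] counit_superset[of ?A g]
        lookup_add distrib_right sum.distrib)
  finally show ?thesis .
qed

lemma counit_single: "counit (Poly_Mapping.single w c) = c * counit_word w"
  by (simp add: counit_superset[of "{w}"])

lemma counit_zero: "counit 0 = 0"
  by (simp add: counit_def)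

lemma free_alg_induct [case_names zero add_single]:
  fixes f :: "'k::field free_alg"
  assumes "P 0" and "\<And>w c f. P f \<Longrightarrow> P (Poly_Mapping.single w c + f)"
  shows "P f"
proof (induction f rule: Poly_Mapping.update_induct)
  case (update f a b)
  have "Poly_Mapping.update a b f = Poly_Mapping.single a b + f"
    using update(1)
    by (intro poly_mapping_eqI)
      (auto simp: lookup_update lookup_add lookup_single when_def in_keys_iff)
  with update assms(2) show ?case by simp
qed (rule assms(1))

lemma counit_mult: "counit (f * g) = counit f * counit g"
proof (induction f rule: free_alg_induct)
  case (add_single v c f)
  have "counit (Poly_Mapping.single v c * g) = counit (Poly_Mapping.single v c) * counit g"
  proof (induction g rule: free_alg_induct)
    case (add_single w d g)
    then show ?case
      by (simp add: distrib_left counit_add mult_single counit_single counit_word_def plus_word_def)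
  qed (simp add: counit_zero)
  with add_single show ?case by (simp add: distrib_right counit_add)
qed (simp add: counit_zero)

lemma counit_uminus: "counit (- f) = - counit f"
  using counit_add[of f "- f"] by (simp add: counit_zero eq_neg_iff_add_eq_0 add.commute)

lemma counit_minus: "counit (f - g) = counit f - counit g"
  using counit_add[of f "- g"] by (simp add: counit_uminus)

lemma counit_one: "counit 1 = 1"
  unfolding single_one[symmetric] by (simp add: counit_single counit_word_def zero_word_def)

lemma counit_gen: "counit (gen z) = counit_gen z"
  by (simp add: gen_def counit_single counit_word_def)

lemma counit_sum: "finite A \<Longrightarrow> counit (\<Sum>a\<in>A. f a) = (\<Sum>a\<in>A. counit (f a))"
  by (induction A rule: finite_induct) (simp_all add: counit_zero counit_add)

lemma inverse_perm_of: "inverse (perm_of r) = perm_of r"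
  by (cases r) simp_all

lemma perm_of_square: "perm_of r * perm_of r = 1"
  by (cases r) simp_all

lemma perm_of_mult_eq_1: "perm_of s * perm_of r = 1 \<longleftrightarrow> s = r"
proof
  assume "perm_of s * perm_of r = 1"
  hence "perm_of s * perm_of r * perm_of r = perm_of r" by simp
  hence "perm_of s = perm_of r" by (simp add: mult.assoc perm_of_square)
  thus "s = r" using inj_perm_of by (simp add: inj_eq)
qed (simp add: perm_of_square)

lemma perm_of_neq_1: "perm_of s \<noteq> 1"
proof
  assume "perm_of s = 1"
  hence "Perm.apply (perm_of s) i = i" for i by simp
  from this[of 1] this[of 2] this[of 3] show False by (cases s) simp_all
qed

lemma counit_relators: "r \<in> relators \<Longrightarrow> counit r = 0"
proof (induction rule: relators.induct)
  case (grp_dlt g h)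
  have "g * h * inverse g = 1 \<longleftrightarrow> h = 1"
  proof
    assume "g * h * inverse g = 1"
    hence "inverse g * (g * h * inverse g) * g = 1" by simp
    hence "(inverse g * g) * h * (inverse g * g) = 1" by (simp only: mult.assoc)
    thus "h = 1" by simp
  qed simp
  then show ?case by (simp add: counit_minus counit_mult counit_gen)
qed (auto simp: counit_minus counit_mult counit_gen counit_one counit_add counit_uminus
      counit_zero counit_sum finite_UNIV_S3 perm_of_mult_eq_1 perm_of_neq_1)

lemma counit_rel_ideal: "u \<in> rel_ideal \<Longrightarrow> counit u = 0"
  by (induction rule: rel_ideal.induct)
    (simp_all add: counit_zero counit_mult counit_add counit_relators)


subsection \<open>Algebra structure\<close>

instantiation double :: (field) ring_1
begin

lift_definition zero_double :: "'a double" is 0 .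
lift_definition one_double :: "'a double" is 1 .

lift_definition plus_double :: "'a double \<Rightarrow> 'a double \<Rightarrow> 'a double" is "(+)"
proof -
  fix a b c d :: "'a free_alg"
  assume "rel_cong a b" "rel_cong c d"
  moreover have "a + c - (b + d) = (a - b) + (c - d)" by simp
  ultimately show "rel_cong (a + c) (b + d)"
    unfolding rel_cong_def by (metis rel_ideal.add)
qed

lift_definition uminus_double :: "'a double \<Rightarrow> 'a double" is uminus
proof -
  fix a b :: "'a free_alg"
  assume "rel_cong a b"
  moreover have "- a - (- b) = - (a - b)" by simp
  ultimately show "rel_cong (- a) (- b)"
    unfolding rel_cong_def by (metis rel_ideal_uminus)
qed

lift_definition minus_double :: "'a double \<Rightarrow> 'a double \<Rightarrow> 'a double" is "(-)"
proof -
  fix a b c d :: "'a free_alg"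
  assume "rel_cong a b" "rel_cong c d"
  moreover have "a - c - (b - d) = (a - b) - (c - d)" by simp
  ultimately show "rel_cong (a - c) (b - d)"
    unfolding rel_cong_def by (metis rel_ideal_diff)
qed

lift_definition times_double :: "'a double \<Rightarrow> 'a double \<Rightarrow> 'a double" is "(*)"
proof -
  fix a b c d :: "'a free_alg"
  assume "rel_cong a b" "rel_cong c d"
  moreover have "a * c - b * d = (a - b) * c + b * (c - d)" by (simp add: algebra_simps)
  ultimately show "rel_cong (a * c) (b * d)"
    unfolding rel_cong_def by (metis rel_ideal.add rel_ideal_lmult rel_ideal_rmult)
qed

instance
proof
  fix a b c :: "'a double"
  show "a * b * c = a * (b * c)" "a + b + c = a + (b + c)" "a + b = b + a" "0 + a = a"
    "1 * a = a" "a * 1 = a" "- a + a = 0" "a - b = a + - b"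
    "(a + b) * c = a * c + b * c" "a * (b + c) = a * b + a * c"
    by (transfer, simp add: rel_cong_def rel_ideal.zero algebra_simps)+
  show "(0 :: 'a double) \<noteq> 1"
  proof (transfer, rule notI)
    assume "rel_cong (0 :: 'a free_alg) 1"
    hence "counit (0 - 1 :: 'a free_alg) = 0" unfolding rel_cong_def by (rule counit_rel_ideal)
    thus False by (simp add: counit_minus counit_zero counit_one del: diff_0)
  qed
qed

end

lift_definition dgen :: "gen \<Rightarrow> 'k::field double" is gen .
lift_definition dconst :: "'k::field \<Rightarrow> 'k double" is const .


section \<open>Weights\<close>

datatype weight =
    E_plus   (* (e,+) *)
  | E_minus  (* (e,-) *)
  | E_rho    (* (e,rho) *)
  | Sigma_plus | Sigma_minus
  | Tau_0 | Tau_1 | Tau_2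


section \<open>Finite-dimensional modules\<close>

locale D_module = vector_space scale
  for scale :: "'k::field \<Rightarrow> 'v::ab_group_add \<Rightarrow> 'v" (infixr \<open>*s\<close> 75) +
  fixes act :: "'k double \<Rightarrow> 'v \<Rightarrow> 'v" (infixr \<open>\<cdot>\<close> 75)
  assumes act_add_right: "d \<cdot> (v + w) = d \<cdot> v + d \<cdot> w"
    and act_add_left: "(d + d') \<cdot> v = d \<cdot> v + d' \<cdot> v"
    and act_mult: "(d * d') \<cdot> v = d \<cdot> (d' \<cdot> v)"
    and act_one: "1 \<cdot> v = v"
    and act_const: "dconst c \<cdot> v = c *s v"
    and finite_dim: "\<exists>B. finite B \<and> span B = UNIV"
begin

definition D_submodule :: "'v set \<Rightarrow> bool" where
  "D_submodule U \<longleftrightarrow> subspace U \<and> (\<forall>d. \<forall>u\<in>U. d \<cdot> u \<in> U)"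

definition simple_D_module :: bool where
  "simple_D_module \<longleftrightarrow>
     (UNIV :: 'v set) \<noteq> {0} \<and> (\<forall>U. D_submodule U \<longrightarrow> U = {0} \<or> U = UNIV)"

definition S3_stable :: "'v set \<Rightarrow> bool" where
  "S3_stable U \<longleftrightarrow> subspace U \<and> (\<forall>g. \<forall>u\<in>U. dgen (Grp g) \<cdot> u \<in> U)"

definition DS3_submodule :: "'v set \<Rightarrow> bool" where
  "DS3_submodule U \<longleftrightarrow> S3_stable U \<and> (\<forall>g. \<forall>u\<in>U. dgen (Dlt g) \<cdot> u \<in> U)"

definition has_degree :: "S3 \<Rightarrow> 'v \<Rightarrow> bool" where
  "has_degree g v \<longleftrightarrow> dgen (Dlt g) \<cdot> v = v"

definition is_basis_of :: "'i set \<Rightarrow> ('i \<Rightarrow> 'v) \<Rightarrow> 'v set \<Rightarrow> bool" where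
  "is_basis_of I b W \<longleftrightarrow> inj_on b I \<and> independent (b ` I) \<and> span (b ` I) = W"

text \<open>
  \<open>iso_character \<chi> W\<close>: \<open>W\<close> is one-dimensional, of degree \<open>e\<close>, with \<open>S\<^sub>3\<close> acting through \<open>\<chi>\<close>.
\<close>

definition iso_character :: "(S3 \<Rightarrow> 'k) \<Rightarrow> 'v set \<Rightarrow> bool" where
  "iso_character \<chi> W \<longleftrightarrow>
     (\<exists>v. v \<noteq> 0 \<and> W = span {v} \<and> has_degree 1 v \<and> (\<forall>g. dgen (Grp g) \<cdot> v = \<chi> g *s v))"

text \<open>The two-dimensional irreducible representation of \<open>S\<^sub>3\<close>, in degree \<open>e\<close>.\<close>

definition iso_rho :: "'v set \<Rightarrow> bool" where
  "iso_rho W \<longleftrightarrow>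
     S3_stable W \<and> dim W = 2 \<and> (\<forall>w\<in>W. has_degree 1 w) \<and>
     (\<forall>U. S3_stable U \<and> U \<subseteq> W \<longrightarrow> U = {0} \<or> U = W)"

text \<open>
  \<open>b T12\<close>, \<open>b T13\<close>, \<open>b T23\<close> are the basis vectors \<open>|12>\<close>, \<open>|13>\<close>, \<open>|23>\<close>; the vector
  \<open>|g(i) g(j)>\<close> is the one indexed by the conjugate of \<open>(ij)\<close> by \<open>g\<close>.
\<close>

definition iso_sigma :: "(S3 \<Rightarrow> 'k) \<Rightarrow> 'v set \<Rightarrow> bool" where
  "iso_sigma \<chi> W \<longleftrightarrow>
     (\<exists>b. is_basis_of UNIV b W \<and> (\<forall>r. has_degree (perm_of r) (b r)) \<and>
        (\<forall>g r. dgen (Grp g) \<cdot> b r = \<chi> g *s b (conjt g r)))"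

text \<open>
  \<open>u\<close> and \<open>w\<close> are the basis vectors \<open>|123>\<close> and \<open>|132>\<close>; the parameter \<open>\<eta>\<close> is \<open>\<zeta> ^ \<ell>\<close>.
  The transposition \<open>(12)\<close> and the cycle \<open>(123)\<close> generate \<open>S\<^sub>3\<close>.
\<close>

definition iso_tau :: "'k \<Rightarrow> 'v set \<Rightarrow> bool" where
  "iso_tau \<eta> W \<longleftrightarrow>
     (\<exists>u w. u \<noteq> w \<and> independent {u, w} \<and> span {u, w} = W \<and>
        has_degree c123 u \<and> has_degree c132 w \<and>
        dgen (Grp (perm_of T12)) \<cdot> u = w \<and> dgen (Grp (perm_of T12)) \<cdot> w = u \<and>
        dgen (Grp c123) \<cdot> u = \<eta> *s u \<and> dgen (Grp c123) \<cdot> w = inverse \<eta> *s w)"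

text \<open>
  The \<open>D(S\<^sub>3)\<close>-submodule \<open>W\<close> is isomorphic to the weight; the isomorphism is spelled out as
  the existence of the basis describing that weight.
\<close>

primrec iso_weight :: "'k \<Rightarrow> weight \<Rightarrow> 'v set \<Rightarrow> bool" where
  "iso_weight \<zeta> E_plus = iso_character (\<lambda>_. 1)"
| "iso_weight \<zeta> E_minus = iso_character sgn3"
| "iso_weight \<zeta> E_rho = iso_rho"
| "iso_weight \<zeta> Sigma_plus = iso_sigma (\<lambda>_. 1)"
| "iso_weight \<zeta> Sigma_minus = iso_sigma sgn3"
| "iso_weight \<zeta> Tau_0 = iso_tau 1"
| "iso_weight \<zeta> Tau_1 = iso_tau \<zeta>"
| "iso_weight \<zeta> Tau_2 = iso_tau (\<zeta> ^ 2)"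

definition has_highest_weight :: "'k \<Rightarrow> weight \<Rightarrow> bool" where
  "has_highest_weight \<zeta> lam \<longleftrightarrow>
     (\<exists>W. DS3_submodule W \<and> iso_weight \<zeta> lam W \<and> (\<forall>r. \<forall>w\<in>W. dgen (Y r) \<cdot> w = 0))"

end

text \<open>
  \<open>is_L \<zeta> lam s a\<close>: the module with scalar multiplication \<open>s\<close> and action \<open>a\<close> is (a copy of) \<open>L(lam)\<close>,
  the simple module of highest weight \<open>lam\<close>.
\<close>

definition is_L :: "'k::field \<Rightarrow> weight \<Rightarrow> ('k \<Rightarrow> 'v::ab_group_add \<Rightarrow> 'v) \<Rightarrow>
    ('k double \<Rightarrow> 'v \<Rightarrow> 'v) \<Rightarrow> bool" where
  "is_L \<zeta> lam s a \<longleftrightarrow>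
     D_module s a \<and> D_module.simple_D_module s a \<and> D_module.has_highest_weight s a \<zeta> lam"

definition D_hom :: "('k::field \<Rightarrow> 'v::ab_group_add \<Rightarrow> 'v) \<Rightarrow> ('k double \<Rightarrow> 'v \<Rightarrow> 'v) \<Rightarrow>
    ('k \<Rightarrow> 'w::ab_group_add \<Rightarrow> 'w) \<Rightarrow> ('k double \<Rightarrow> 'w \<Rightarrow> 'w) \<Rightarrow> ('v \<Rightarrow> 'w) \<Rightarrow> bool" where
  "D_hom s a s' a' f \<longleftrightarrow> Vector_Spaces.linear s s' f \<and> (\<forall>d v. f (a d v) = a' d (f v))"

definition D_isomorphic :: "('k::field \<Rightarrow> 'v::ab_group_add \<Rightarrow> 'v) \<Rightarrow> ('k double \<Rightarrow> 'v \<Rightarrow> 'v) \<Rightarrow>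
    ('k \<Rightarrow> 'w::ab_group_add \<Rightarrow> 'w) \<Rightarrow> ('k double \<Rightarrow> 'w \<Rightarrow> 'w) \<Rightarrow> bool" where
  "D_isomorphic s a s' a' \<longleftrightarrow> (\<exists>f. D_hom s a s' a' f \<and> bij f)"

definition short_exact ::
    "('k::field \<Rightarrow> 'u::ab_group_add \<Rightarrow> 'u) \<Rightarrow> ('k double \<Rightarrow> 'u \<Rightarrow> 'u) \<Rightarrow>
     ('k \<Rightarrow> 'v::ab_group_add \<Rightarrow> 'v) \<Rightarrow> ('k double \<Rightarrow> 'v \<Rightarrow> 'v) \<Rightarrow>
     ('k \<Rightarrow> 'w::ab_group_add \<Rightarrow> 'w) \<Rightarrow> ('k double \<Rightarrow> 'w \<Rightarrow> 'w) \<Rightarrow>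
     ('u \<Rightarrow> 'v) \<Rightarrow> ('v \<Rightarrow> 'w) \<Rightarrow> bool" where
  "short_exact s1 a1 s2 a2 s3 a3 i p \<longleftrightarrow>
     D_hom s1 a1 s2 a2 i \<and> D_hom s2 a2 s3 a3 p \<and> inj i \<and> surj p \<and> range i = {v. p v = 0}"

definition sum_scale :: "('k::field \<Rightarrow> 'u::ab_group_add \<Rightarrow> 'u) \<Rightarrow> ('k \<Rightarrow> 'w::ab_group_add \<Rightarrow> 'w) \<Rightarrow>
    'k \<Rightarrow> 'u \<times> 'w \<Rightarrow> 'u \<times> 'w" where
  "sum_scale s s' = module_prod.scale s s'"

definition sum_act :: "('k::field double \<Rightarrow> 'u \<Rightarrow> 'u) \<Rightarrow> ('k double \<Rightarrow> 'w \<Rightarrow> 'w) \<Rightarrow>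
    'k double \<Rightarrow> 'u \<times> 'w \<Rightarrow> 'u \<times> 'w" where
  "sum_act a a' d = map_prod (a d) (a' d)"

end

theory Submission
  imports Defs
begin

text \<open>
  Write \<open>p\<close> for the projection of the extension \<open>E\<close> onto \<open>L(\<lambda>)\<close>.  A submodule of \<open>E\<close> that meets the kernel of \<open>p\<close> in
  zero and is not mapped to zero is a complement of \<open>L(\<mu>)\<close>, because \<open>L(\<lambda>)\<close> is simple.  It is found as the
  submodule generated by a suitable copy of the weight \<open>\<lambda>\<close> in \<open>E\<close>, and what makes this work is the list of weights that occur.

  The modules \<open>L(\<epsilon>)\<close>, \<open>L(e,\<rho>)\<close>, \<open>L(\<tau>,0)\<close> and \<open>L(\<sigma>,-)\<close> are small: from top to bottom they consist of the weights \<open>\<epsilon>\<close>;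
  \<open>(e,\<rho>), (\<sigma>,+), (\<tau>,0)\<close>; \<open>(\<tau>,0), (\<sigma>,+), (e,\<rho>)\<close>; and \<open>(\<sigma>,-), (\<tau>,1) \<oplus> (\<tau>,2), (\<sigma>,-)\<close>.  This is shown with explicit
  bases (\<open>rho_submodule\<close>, \<open>tau_submodule\<close>, \<open>sigma_submodule\<close>).  The vectors by which a Verma module differs from these
  are singular, and a simple module contains no nonzero singular vectors of the form \<open>\<Sum> x\<^sub>r v\<^sub>r\<close>, because \<open>V\<close> acts
  nilpotently (\<open>simple_singular\<close>).  So the first three modules have only the weights
  \<open>\<epsilon>, (e,\<rho>), (\<sigma>,+), (\<tau>,0)\<close>, called even type below, and the last one only \<open>(\<sigma>,-), (\<tau>,1), (\<tau>,2)\<close>, called odd type.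
  In characteristic zero both types are inherited by extensions, so \<open>E\<close> has the same type (\<open>even_type\<close>, \<open>odd_type\<close>).

  Now lift the top weight \<open>\<lambda>\<close> of \<open>L(\<lambda>)\<close> to \<open>E\<close>.  For \<open>\<lambda> = \<epsilon>\<close> every \<open>x\<close> and \<open>y\<close> maps the lift into a copy of \<open>(\<sigma>,-)\<close>,
  which does not occur, so the lift spans a submodule.  In the other cases the \<open>y\<close>'s need not kill the lift, but they
  kill a corrected one, whose vectors have the form \<open>y\<^sub>r x\<^sub>r v\<close>: the missing weights force enough of these vectors to
  coincide for \<open>y\<^sub>r\<^sup>2 = 0\<close> to apply to every \<open>y\<^sub>r\<close> (\<open>even_rho_correct\<close>, \<open>even_tau_correct\<close>, \<open>odd_sigma_correct\<close>).  Since
  \<open>y\<^sub>r x\<^sub>r\<close> acts on the top of \<open>L(\<lambda>)\<close> by \<open>1\<close> or \<open>2\<close>, the corrected lift is not mapped to zero.  The relations that cut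
  \<open>L(\<lambda>)\<close> out of the Verma module hold for it, again because they concern missing weights, so it generates
  an explicit copy \<open>N\<close> of \<open>L(\<lambda>)\<close>.  Every nonzero submodule of \<open>N\<close> contains the top of \<open>N\<close>, which \<open>p\<close> does not kill, so
  \<open>N\<close> meets the kernel of \<open>p\<close> in zero (\<open>split_by_simplicity\<close>).
\<close>

section \<open>The symmetric group and its transpositions\<close>

text \<open>
  The three transpositions are ordered cyclically in such a way that \<open>r * nxt r\<close> is always the
  rotation \<open>(123)\<close> and \<open>r * prv r\<close> is always \<open>(132)\<close>.  Two transpositions are then equal, next or
  previous to each other, and every computation with degrees splits into these three cases.
\<close>

primrec nxt :: "transposition \<Rightarrow> transposition" where
  "nxt T12 = T23" | "nxt T23 = T13" | "nxt T13 = T12"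

primrec prv :: "transposition \<Rightarrow> transposition" where
  "prv T12 = T13" | "prv T13 = T23" | "prv T23 = T12"

text \<open>
  Conjugation \<open>t r t\<close> on the transpositions, as a table that can be evaluated.
\<close>

definition reflect :: "transposition \<Rightarrow> transposition \<Rightarrow> transposition" where
  "reflect t r = (if r = t then t else if r = nxt t then prv t else nxt t)"

text \<open>
  Opaque names for \<open>(123)\<close> and \<open>(132)\<close>: the simplifier expands \<open>cycle [1,2,3]\<close> into a product of swaps.
\<close>

definition rot :: S3 where "rot = perm_of T12 * perm_of T23"
definition rot' :: S3 where "rot' = perm_of T12 * perm_of T13"

lemma S3_eqI:
  fixes g h :: S3
  assumes "Perm.apply g 1 = Perm.apply h 1" "Perm.apply g 2 = Perm.apply h 2"
    "Perm.apply g 3 = Perm.apply h 3"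
  shows "g = h"
  by (rule perm_eqI) (use assms letters_exhaust in metis)

lemma c123_eq: "c123 = rot" and c132_eq: "c132 = rot'"
  by (rule S3_eqI; simp add: rot_def rot'_def apply_times)+

lemma perm_of_mult:
  "perm_of t * perm_of r = (if r = t then 1 else if r = nxt t then rot else rot')"
  by (cases t; cases r; simp; (intro conjI impI)?;
      rule S3_eqI; simp add: rot_def rot'_def apply_times)

lemma perm_of_mult_rot: "perm_of t * rot = perm_of (nxt t)" "perm_of t * rot' = perm_of (prv t)"
  by (cases t; rule S3_eqI; simp add: rot_def rot'_def apply_times)+

lemma transposition_cases: "r = t \<or> r = nxt t \<or> r = prv t"
  by (cases r; cases t; simp)

lemma nxt_prv [simp]: "nxt (prv r) = r" "prv (nxt r) = r" "nxt (nxt r) = prv r" "prv (prv r) = nxt r"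
  "nxt r \<noteq> r" "r \<noteq> nxt r" "prv r \<noteq> r" "r \<noteq> prv r" "nxt r \<noteq> prv r" "prv r \<noteq> nxt r"
  by (cases r; simp)+

lemma reflect_simps [simp]: "reflect t t = t" "reflect t (nxt t) = prv t" "reflect t (prv t) = nxt t"
   "reflect (nxt t) t = prv t"  "reflect (prv t) t = nxt t"
   "reflect (prv t) (nxt t) = t"  "reflect (nxt t) (prv t) = t"
  by (cases t; simp add: reflect_def)+

lemma nxt_reflect [simp]: "nxt (reflect t r) = reflect t (prv r)" "prv (reflect t r) = reflect t (nxt r)"
  by (cases t; cases r; simp add: reflect_def)+

lemma reflect_eq_iff [simp]: "reflect t r = reflect t s \<longleftrightarrow> r = s"
  by (cases t; cases r; cases s; simp add: reflect_def)

lemma perm_of_conj: "perm_of t * perm_of r * perm_of t = perm_of (reflect t r)"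
  by (cases t; cases r; simp add: reflect_def; rule S3_eqI; simp add: apply_times)

lemma rot_conj: "perm_of t * rot * perm_of t = rot'" "perm_of t * rot' * perm_of t = rot"
  by (simp_all add: perm_of_mult_rot perm_of_mult)

lemma conjt_perm_of: "conjt (perm_of t) r = reflect t r"
  by (rule injD[OF inj_perm_of]) (simp add: perm_of_conjt inverse_perm_of perm_of_conj)

lemma perm_of_eq_iff [simp]: "perm_of r = perm_of s \<longleftrightarrow> r = s"
  using inj_perm_of by (simp add: inj_eq)

lemma apply_rot: "Perm.apply rot 1 = 2" "Perm.apply rot 2 = 3" "Perm.apply rot 3 = 1"
  "Perm.apply rot' 1 = 3" "Perm.apply rot' 2 = 1" "Perm.apply rot' 3 = 2"
  by (simp_all add: rot_def rot'_def apply_times)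

lemma S3_distinct [simp]:
  "rot \<noteq> 1" "rot' \<noteq> 1" "rot \<noteq> rot'" "perm_of r \<noteq> 1" "perm_of r \<noteq> rot" "perm_of r \<noteq> rot'"
proof -
  show "rot \<noteq> 1" "rot' \<noteq> 1"
    unfolding rot_def rot'_def by (simp_all only: perm_of_mult_eq_1, simp_all)
  show "rot \<noteq> rot'"
    using apply_rot letters_distinct by metis
  show "perm_of r \<noteq> 1" by (rule perm_of_neq_1)
  have "perm_of s \<noteq> perm_of r * perm_of s" for s
    using perm_of_neq_1[of r] by (metis mult_1_left mult.assoc perm_of_square mult_1_right)
  from this[of "nxt r"] this[of "prv r"] show "perm_of r \<noteq> rot" "perm_of r \<noteq> rot'"
    using perm_of_mult[of r "nxt r"] perm_of_mult[of r "prv r"]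
    by (metis perm_of_mult_rot mult.assoc mult_1_left perm_of_square nxt_prv perm_of_eq_iff perm_of_neq_1)+
qed
lemmas S3_distinct' [simp] = S3_distinct[symmetric]

lemma S3_exhaust: "(g::S3) = 1 \<or> g = rot \<or> g = rot' \<or> (\<exists>r. g = perm_of r)"
proof -
  have vals: "Perm.apply (perm_of T12) 1 = 2" "Perm.apply (perm_of T12) 2 = 1" "Perm.apply (perm_of T12) 3 = 3"
    "Perm.apply (perm_of T13) 1 = 3" "Perm.apply (perm_of T13) 2 = 2" "Perm.apply (perm_of T13) 3 = 1"
    "Perm.apply (perm_of T23) 1 = 1" "Perm.apply (perm_of T23) 2 = 3" "Perm.apply (perm_of T23) 3 = 2"
    by simp_all
  note eq = S3_eqI[of g rot] S3_eqI[of g rot'] S3_eqI[of g 1] S3_eqI[of g "perm_of T12"]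
     S3_eqI[of g "perm_of T13"] S3_eqI[of g "perm_of T23"]
  have inj: "Perm.apply g 1 \<noteq> Perm.apply g 2" "Perm.apply g 1 \<noteq> Perm.apply g 3"
    "Perm.apply g 2 \<noteq> Perm.apply g 3" by (simp_all add: apply_inj)
  then show ?thesis
    using letters_exhaust[of "Perm.apply g 1"] letters_exhaust[of "Perm.apply g 2"]
      letters_exhaust[of "Perm.apply g 3"] eq
    unfolding vals apply_rot apply_one id_apply by metis
qed

text \<open>
  Otherwise the simplifier would turn the transpositions into swaps, to which the multiplication table above does
  not apply.
\<close>

declare perm_of.simps [simp del]


section \<open>The relations of the double as identities between operators\<close>

lemma double_relation: "f - g \<in> relators \<Longrightarrow> abs_double f = abs_double g"
  using rel_ideal.base[of "f - g" 1 1] by (simp add: double.abs_eq_iff rel_cong_def)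

lemma sgn3_perm_of: "sgn3 (perm_of r) = (- 1 :: 'a::ring_1)"
proof -
  have "Perm.apply (Perm.swap a b) = Transposition.transpose a b" for a b :: 3
    by (rule ext) (simp add: Transposition.transpose_def)
  then show ?thesis by (cases r) (simp_all add: perm_of.simps sgn3_def sign_swap_id)
qed

lemmas to_double = dgen.abs_eq[symmetric] dconst.abs_eq[symmetric] times_double.abs_eq[symmetric]
  plus_double.abs_eq[symmetric] minus_double.abs_eq[symmetric] uminus_double.abs_eq[symmetric]
  one_double_def[symmetric] zero_double_def[symmetric]

lemma const_commute: "const c * d = d * const c"
proof (induction d rule: free_alg_induct)
  case (add_single w e f)
  then show ?case by (simp add: distrib_left distrib_right const_def mult_single mult.commute)
qed simp

lemma dconst_commute: "dconst c * d = d * dconst c"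
  by transfer (simp add: rel_cong_def const_commute rel_ideal.zero)

context D_module
begin

text \<open>
  The generators as operators on a module.  The permutations other than the identity and the
  transpositions are products of two transpositions, so \<open>RR\<close> is enough to describe \<open>S\<^sub>3\<close>.
\<close>

abbreviation RR :: "transposition \<Rightarrow> 'v \<Rightarrow> 'v" where "RR t v \<equiv> dgen (Grp (perm_of t)) \<cdot> v"
abbreviation DD :: "S3 \<Rightarrow> 'v \<Rightarrow> 'v" where "DD g v \<equiv> dgen (Dlt g) \<cdot> v"
abbreviation XX :: "transposition \<Rightarrow> 'v \<Rightarrow> 'v" where "XX t v \<equiv> dgen (X t) \<cdot> v"
abbreviation YY :: "transposition \<Rightarrow> 'v \<Rightarrow> 'v" where "YY t v \<equiv> dgen (Y t) \<cdot> v"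

lemma act_zero_right [simp]: "d \<cdot> 0 = 0"
  using act_add_right[of d 0 0] by simp
lemma act_zero_left [simp]: "0 \<cdot> v = 0"
  using act_add_left[of 0 0 v] by simp
lemma act_uminus_right [simp]: "d \<cdot> (- v) = - (d \<cdot> v)"
  using act_add_right[of d v "- v"] by (simp add: eq_neg_iff_add_eq_0 add.commute)
lemma act_uminus_left [simp]: "(- d) \<cdot> v = - (d \<cdot> v)"
  using act_add_left[of d "- d" v] by (simp add: eq_neg_iff_add_eq_0 add.commute)
lemma act_diff_right: "d \<cdot> (v - w) = d \<cdot> v - d \<cdot> w"
  using act_add_right[of d v "- w"] by simp
lemma act_diff_left: "(d - d') \<cdot> v = d \<cdot> v - d' \<cdot> v"
  using act_add_left[of d "- d'" v] by simp
lemma act_scale: "d \<cdot> (c *s v) = c *s (d \<cdot> v)"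
  by (metis act_const act_mult dconst_commute)
lemma act_sum_left: "(\<Sum>i\<in>I. f i) \<cdot> v = (\<Sum>i\<in>I. f i \<cdot> v)"
  by (induction I rule: infinite_finite_induct) (simp_all add: act_add_left)
lemmas act_linear = act_add_right act_diff_right act_scale

lemma RR_mult: "dgen (Grp g) \<cdot> dgen (Grp h) \<cdot> v = dgen (Grp (g * h)) \<cdot> v"
proof -
  have "dgen (Grp g) * dgen (Grp h) = (dgen (Grp (g * h)) :: 'k double)"
    using double_relation[OF relators.grp_mult[of g h]] unfolding to_double .
  then show ?thesis by (metis act_mult)
qed

lemma Grp_one: "dgen (Grp 1) \<cdot> v = v"
proof -
  have "dgen (Grp 1) = (1 :: 'k double)"
    using double_relation[OF relators.grp_one] unfolding to_double .
  then show ?thesis by (simp add: act_one)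
qed

lemma RR_RR [simp]: "RR t (RR t v) = v"
  by (simp add: RR_mult perm_of_square Grp_one)

lemma RR_cycle: "RR t (RR (nxt t) v) = dgen (Grp rot) \<cdot> v" "RR t (RR (prv t) v) = dgen (Grp rot') \<cdot> v"
  by (simp_all add: RR_mult perm_of_mult)

lemma RR_braid: "RR t (RR r v) = RR (reflect t r) (RR t v)"
proof -
  have "perm_of (reflect t r) * perm_of t = perm_of t * perm_of r"
    by (metis perm_of_conj mult.assoc perm_of_square mult_1_right)
  then show ?thesis by (simp only: RR_mult)
qed

lemma DD_DD: "DD g (DD h v) = (if g = h then DD g v else 0)"
proof -
  have "dgen (Dlt g) * dgen (Dlt h) = (if g = h then dgen (Dlt g) else 0 :: 'k double)"
    using double_relation[OF relators.dlt_mult[of g h]]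
    by (cases "g = h") (simp_all add: to_double)
  then show ?thesis by (metis act_mult act_zero_left)
qed

lemma DD_sum: "(\<Sum>g\<in>UNIV. DD g v) = v"
proof -
  have *: "abs_double (\<Sum>g\<in>A. gen (Dlt g)) = (\<Sum>g\<in>A. dgen (Dlt g) :: 'k double)" if "finite A" for A
    using that by (induction A rule: finite_induct) (simp_all add: to_double)
  have "(\<Sum>g\<in>UNIV. dgen (Dlt g)) = (1 :: 'k double)"
    using double_relation[OF relators.dlt_sum[where 'k = 'k]] unfolding *[OF finite_UNIV_S3] to_double .
  then show ?thesis by (metis act_sum_left act_one)
qed

lemma RR_DD: "RR t (DD g v) = DD (perm_of t * g * perm_of t) (RR t v)"
proof -
  have "dgen (Grp (perm_of t)) * dgen (Dlt g) * dgen (Grp (perm_of t))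
      = (dgen (Dlt (perm_of t * g * perm_of t)) :: 'k double)"
    using double_relation[OF relators.grp_dlt[of "perm_of t" g]]
    unfolding to_double inverse_perm_of .
  then have "RR t (DD g (RR t w)) = DD (perm_of t * g * perm_of t) w" for w
    by (metis act_mult)
  from this[of "RR t v"] show ?thesis by simp
qed

lemma DD_XY: assumes "z \<in> {X, Y}"
  shows "DD g (dgen (z r) \<cdot> v) = dgen (z r) \<cdot> DD (perm_of r * g) v"
proof -
  have "dgen (Dlt g) * dgen (z r) = (dgen (z r) * dgen (Dlt (perm_of r * g)) :: 'k double)"
    using double_relation[OF relators.dlt_boson[OF assms, of g r]] unfolding to_double .
  then show ?thesis by (metis act_mult)
qed
lemmas DD_XX = DD_XY[of X, simplified] and DD_YY = DD_XY[of Y, simplified]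

lemma RR_XY: assumes "z \<in> {X, Y}"
  shows "RR t (dgen (z r) \<cdot> v) = - (dgen (z (reflect t r)) \<cdot> RR t v)"
proof -
  have m1: "dconst (- 1) = (- 1 :: 'k double)"
    by (transfer, unfold rel_cong_def const_def) (simp flip: single_uminus single_one add: rel_ideal.zero)
  have "dgen (Grp (perm_of t)) * dgen (z r) * dgen (Grp (perm_of t)) = (- dgen (z (reflect t r)) :: 'k double)"
    using double_relation[OF relators.grp_boson[OF assms, of "perm_of t" r, where 'k = 'k]]
    unfolding to_double inverse_perm_of sgn3_perm_of conjt_perm_of m1 by simp
  then have "RR t (dgen (z r) \<cdot> RR t w) = - (dgen (z (reflect t r)) \<cdot> w)" for w
    by (metis act_mult act_uminus_left)
  from this[of "RR t v"] show ?thesis by simp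
qed
lemmas RR_XX = RR_XY[of X, simplified] and RR_YY = RR_XY[of Y, simplified]

lemma XY_square: assumes "z \<in> {X, Y}" shows "dgen (z r) \<cdot> dgen (z r) \<cdot> v = 0"
proof -
  have "dgen (z r) * dgen (z r) = (0 :: 'k double)"
    using double_relation[of _ 0, unfolded diff_0_right, OF relators.nichols_square[OF assms, of r]]
    unfolding to_double .
  then show ?thesis by (metis act_mult act_zero_left)
qed
lemmas XX_XX [simp] = XY_square[of X, simplified] and YY_YY [simp] = XY_square[of Y, simplified]

lemma XY_nichols: assumes "z \<in> {X, Y}"
  shows "dgen (z T12) \<cdot> dgen (z T13) \<cdot> v + dgen (z T23) \<cdot> dgen (z T12) \<cdot> v + dgen (z T13) \<cdot> dgen (z T23) \<cdot> v = 0"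
    and "dgen (z T13) \<cdot> dgen (z T12) \<cdot> v + dgen (z T12) \<cdot> dgen (z T23) \<cdot> v + dgen (z T23) \<cdot> dgen (z T13) \<cdot> v = 0"
proof -
  have "dgen (z T12) * dgen (z T13) + dgen (z T23) * dgen (z T12) + dgen (z T13) * dgen (z T23) = (0 :: 'k double)"
    using double_relation[of _ 0, unfolded diff_0_right, OF relators.nichols_1[OF assms]]
    unfolding to_double .
  then show "dgen (z T12) \<cdot> dgen (z T13) \<cdot> v + dgen (z T23) \<cdot> dgen (z T12) \<cdot> v + dgen (z T13) \<cdot> dgen (z T23) \<cdot> v = 0"
    by (metis act_mult act_zero_left act_add_left)
  have "dgen (z T13) * dgen (z T12) + dgen (z T12) * dgen (z T23) + dgen (z T23) * dgen (z T13) = (0 :: 'k double)"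
    using double_relation[of _ 0, unfolded diff_0_right, OF relators.nichols_2[OF assms]]
    unfolding to_double .
  then show "dgen (z T13) \<cdot> dgen (z T12) \<cdot> v + dgen (z T12) \<cdot> dgen (z T23) \<cdot> v + dgen (z T23) \<cdot> dgen (z T13) \<cdot> v = 0"
    by (metis act_mult act_zero_left act_add_left)
qed

text \<open>
  The two quadratic relations, written in the cyclic order so that they hold for every \<open>t\<close>.
\<close>

lemma XX_nichols: "XX t (XX (prv t) v) + XX (nxt t) (XX t v) + XX (prv t) (XX (nxt t) v) = 0"
  "XX t (XX (nxt t) v) + XX (nxt t) (XX (prv t) v) + XX (prv t) (XX t v) = 0"
  using XY_nichols[of X v] by (cases t; simp add: ac_simps)+

lemma cross: "YY s (XX r v) = - XX r (YY (reflect r s) v) + (if s = r then v else 0)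
    + RR r (DD (perm_of s) v) - RR r (DD (perm_of s * perm_of r) v)"
proof -
  have "dgen (Y s) * dgen (X r) = - (dgen (X r) * dgen (Y (reflect r s))) + (if s = r then 1 else 0)
     + dgen (Grp (perm_of r)) * (dgen (Dlt (perm_of s)) - dgen (Dlt (perm_of s * perm_of r)) :: 'k double)"
    using double_relation[OF relators.cross[of s r]] unfolding conjt_perm_of
    by (cases "s = r") (simp_all add: to_double)
  then show ?thesis
    by (auto simp: act_mult[symmetric] act_add_left[symmetric])
      (simp_all add: act_mult act_add_left act_diff_left act_diff_right act_one)
qed

text \<open>
  Closure under the double follows from closure under its generators because every element is a linear
  combination of words in them.
\<close>

lemma act_closed:
  assumes "subspace U" and gen: "\<And>z u. u \<in> U \<Longrightarrow> dgen z \<cdot> u \<in> U" and "u \<in> U"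
  shows "d \<cdot> u \<in> U"
proof -
  have word: "abs_double (Poly_Mapping.single (Word zs) c) \<cdot> u \<in> U" for zs c
  proof (induction zs)
    case Nil
    have "abs_double (Poly_Mapping.single (Word []) c) = dconst c"
      by (simp add: dconst.abs_eq const_def zero_word_def)
    then show ?case using assms(1,3) by (simp add: act_const subspace_scale)
  next
    case (Cons z zs)
    have "Poly_Mapping.single (Word (z # zs)) c = gen z * Poly_Mapping.single (Word zs) c"
      by (simp add: gen_def mult_single plus_word_def)
    then have "abs_double (Poly_Mapping.single (Word (z # zs)) c)
        = dgen z * abs_double (Poly_Mapping.single (Word zs) c)"
      by (simp add: to_double)
    then show ?case using gen[OF Cons] by (simp add: act_mult)
  qed
  have "abs_double f \<cdot> u \<in> U" for f
  proof (induction f rule: free_alg_induct)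
    case zero
    then show ?case using subspace_0[OF assms(1)] by (simp add: to_double)
  next
    case (add_single w c f)
    then show ?case using word[of "letters w" c] subspace_add[OF assms(1)]
      by (simp add: to_double act_add_left)
  qed
  then show ?thesis by (induction d rule: double.abs_induct) simp
qed

lemma Grp_closed:
  assumes "\<And>t u. u \<in> U \<Longrightarrow> RR t u \<in> U" "u \<in> U"
  shows "dgen (Grp g) \<cdot> u \<in> U"
  using S3_exhaust[of g] assms RR_cycle[of T12 u] Grp_one[of u] by metis

lemma D_submoduleI:
  assumes "subspace U" "\<And>t u. u \<in> U \<Longrightarrow> RR t u \<in> U" "\<And>g u. u \<in> U \<Longrightarrow> DD g u \<in> U"
    "\<And>t u. u \<in> U \<Longrightarrow> XX t u \<in> U" "\<And>t u. u \<in> U \<Longrightarrow> YY t u \<in> U"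
  shows "D_submodule U"
  unfolding D_submodule_def
proof (intro conjI allI ballI assms(1))
  fix d u assume "u \<in> U"
  show "d \<cdot> u \<in> U"
  proof (rule act_closed[OF assms(1) _ \<open>u \<in> U\<close>])
    fix z u assume "u \<in> U"
    then show "dgen z \<cdot> u \<in> U"
      using assms Grp_closed[of U] by (cases z) auto
  qed
qed


section \<open>Degrees and singular vectors\<close>

lemma sum3_eq_0D: assumes "a + b + c = 0" shows "c = - a - (b :: 'v)"
proof -
  have "c = (a + b + c) - a - b" by simp
  with assms show ?thesis by simp
qed

lemma span_pairE:
  assumes "v \<in> span {a, b}"
  obtains p q where "v = p *s a + q *s b"
proof -
  from assms obtain p where "v - p *s a \<in> span {b}" unfolding span_insert by blast
  then obtain q where "v - p *s a = q *s b" unfolding span_singleton by blast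
  then have "v = p *s a + q *s b" by (simp add: algebra_simps)
  then show thesis by (rule that)
qed

lemma DD_deg: "has_degree g v \<Longrightarrow> DD h v = (if h = g then v else 0)"
  unfolding has_degree_def by (metis DD_DD)

lemma deg_XX: "has_degree g v \<Longrightarrow> has_degree (perm_of t * g) (XX t v)"
  and deg_YY: "has_degree g v \<Longrightarrow> has_degree (perm_of t * g) (YY t v)"
  by (simp_all add: has_degree_def DD_XX DD_YY perm_of_square flip: mult.assoc)

lemma deg_RR: "has_degree g v \<Longrightarrow> has_degree (perm_of t * g * perm_of t) (RR t v)"
  by (simp add: has_degree_def flip: RR_DD)

lemma deg_DD: "has_degree g (DD g v)"
  by (simp add: has_degree_def DD_DD)

lemma deg_linear:
  "has_degree g v \<Longrightarrow> has_degree g w \<Longrightarrow> has_degree g (v + w)"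
  "has_degree g v \<Longrightarrow> has_degree g w \<Longrightarrow> has_degree g (v - w)"
  "has_degree g v \<Longrightarrow> has_degree g (- v)"
  "has_degree g v \<Longrightarrow> has_degree g (c *s v)"
  "has_degree g 0"
  by (simp_all add: has_degree_def act_linear)

lemma deg_XX_shift:
  "has_degree 1 v \<Longrightarrow> has_degree (perm_of t) (XX t v)"
  "has_degree rot v \<Longrightarrow> has_degree (perm_of (nxt t)) (XX t v)"
  "has_degree rot' v \<Longrightarrow> has_degree (perm_of (prv t)) (XX t v)"
  "has_degree (perm_of r) v \<Longrightarrow> has_degree (if r = t then 1 else if r = nxt t then rot else rot') (XX t v)"
  by (drule deg_XX[of _ _ t], simp only: perm_of_mult perm_of_mult_rot mult_1_right)+

lemma deg_YY_shift:
  "has_degree 1 v \<Longrightarrow> has_degree (perm_of t) (YY t v)"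
  "has_degree rot v \<Longrightarrow> has_degree (perm_of (nxt t)) (YY t v)"
  "has_degree rot' v \<Longrightarrow> has_degree (perm_of (prv t)) (YY t v)"
  "has_degree (perm_of r) v \<Longrightarrow> has_degree (if r = t then 1 else if r = nxt t then rot else rot') (YY t v)"
  by (drule deg_YY[of _ _ t], simp only: perm_of_mult perm_of_mult_rot mult_1_right)+

lemma deg_RR_shift:
  "has_degree 1 v \<Longrightarrow> has_degree 1 (RR t v)"
  "has_degree rot v \<Longrightarrow> has_degree rot' (RR t v)"
  "has_degree rot' v \<Longrightarrow> has_degree rot (RR t v)"
  "has_degree (perm_of r) v \<Longrightarrow> has_degree (perm_of (reflect t r)) (RR t v)"
  by (drule deg_RR[of _ _ t], simp only: rot_conj perm_of_conj perm_of_square mult_1_right)+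

lemmas deg_shift = deg_XX_shift deg_YY_shift deg_RR_shift

text \<open>
  On a homogeneous vector the projections in the cross relation are zero or the identity; the next four
  lemmas list the outcome for each degree.
\<close>

lemma cross_deg_1:
  assumes "has_degree 1 v"
  shows "YY s (XX r v) = (if s = r then v - RR r v else 0) - XX r (YY (reflect r s) v)"
  unfolding cross[of s r v] DD_deg[OF assms] by (simp add: perm_of_mult)

lemma cross_deg_rot:
  assumes "has_degree rot v"
  shows "YY s (XX r v) = (if s = r then v else 0) - (if r = nxt s then RR r v else 0) - XX r (YY (reflect r s) v)"
  unfolding cross[of s r v] DD_deg[OF assms] by (simp add: perm_of_mult)

lemma cross_deg_rot':
  assumes "has_degree rot' v"
  shows "YY s (XX r v) = (if s = r then v else 0) - (if r = prv s then RR r v else 0) - XX r (YY (reflect r s) v)"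
  using transposition_cases[of r s]
  unfolding cross[of s r v] DD_deg[OF assms] by (auto simp: perm_of_mult)

lemma cross_deg_perm_of:
  assumes "has_degree (perm_of q) v"
  shows "YY s (XX r v) = (if s = r then v else 0) + (if s = q then RR r v else 0) - XX r (YY (reflect r s) v)"
  unfolding cross[of s r v] DD_deg[OF assms] by (simp add: perm_of_mult)

text \<open>
  The relation \<open>x\<^sub>t x\<^sub>p + x\<^sub>n x\<^sub>t + x\<^sub>p x\<^sub>n = 0\<close>, multiplied by \<open>x\<^sub>n\<close> on the right or by \<open>x\<^sub>t\<close> on the left, loses
  one term and contains \<open>x\<^sub>t x\<^sub>p x\<^sub>n\<close> in both cases; subtracting gives the braid relation.
\<close>

lemma XX_braid: "XX t (XX r (XX t v)) = XX r (XX t (XX r v))"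
proof -
  have *: "XX t (XX (nxt t) (XX t v)) = XX (nxt t) (XX t (XX (nxt t) v))" for t v
  proof -
    have "XX t (XX (prv t) (XX (nxt t) v)) + XX (nxt t) (XX t (XX (nxt t) v)) = 0"
      using XX_nichols(1)[of t "XX (nxt t) v"] by simp
    moreover have "XX t (XX (nxt t) (XX t v)) + XX t (XX (prv t) (XX (nxt t) v)) = 0"
      using XX_nichols(1)[of t v, THEN arg_cong[of _ _ "XX t"]] by (simp add: act_add_right)
    ultimately show ?thesis by (metis add.commute add_left_imp_eq)
  qed
  show ?thesis
    using transposition_cases[of r t] *[of t] *[of r] by auto
qed

text \<open>
  The quadratic relations move \<open>x\<close> with index \<open>(23)\<close> to the right, where at most one such factor survives.
  What remains is a word of length at least four in the other two letters, and such words vanish by the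
  braid relation and the vanishing of squares.
\<close>

lemma XX_nilpotent: "XX r1 (XX r2 (XX r3 (XX r4 (XX r5 v)))) = 0"
proof -
  have 1: "XX T23 (XX T12 v) = - XX T12 (XX T13 v) - XX T13 (XX T23 v)" for v
    using XX_nichols(1)[of T12 v] by (simp add: eq_neg_iff_add_eq_0 algebra_simps)
  have 2: "XX T23 (XX T13 v) = - XX T13 (XX T12 v) - XX T12 (XX T23 v)" for v
    using XX_nichols(2)[of T12 v] by (simp add: eq_neg_iff_add_eq_0 algebra_simps)
  have 3: "XX T13 (XX T12 (XX T13 v)) = XX T12 (XX T13 (XX T12 v))" for v
    by (rule XX_braid)
  note simps = 1 2 3 act_linear XX_XX act_zero_right act_uminus_right minus_zero diff_zero diff_0 minus_minus
  show ?thesis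
    by (cases r1; cases r2; cases r3; cases r4; cases r5; simp only: simps)
qed

text \<open>
  The subspace \<open>V M\<close> of the module \<open>M\<close>.
\<close>

definition lowered :: "'v set" where
  "lowered = span (\<Union>r. range (XX r))"

lemma XX_lowered: "XX r v \<in> lowered"
  unfolding lowered_def by (rule span_base) auto

text \<open>
  If \<open>V M = M\<close> then \<open>M = V\<^sup>n M\<close> for every \<open>n\<close>, while five factors from \<open>V\<close> annihilate \<open>M\<close>.
\<close>

lemma lowered_proper:
  assumes "lowered = UNIV" shows "(v :: 'v) = 0"
proof -
  have "w \<in> span {foldr XX rs v | rs v. length rs = n}" for n w
  proof (induction n arbitrary: w)
    case 0
    show ?case by (rule span_base) auto
  next
    case (Suc n)
    let ?S = "span {foldr XX rs v | rs v. length rs = Suc n}"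
    have "XX r w \<in> ?S" for r w
      using Suc[of w]
    proof (induction rule: span_induct_alt)
      case base
      then show ?case by (simp add: span_zero)
    next
      case (step c z y)
      then obtain rs v where "z = foldr XX rs v" "length rs = n" by auto
      then have "XX r z = foldr XX (r # rs) v" "length (r # rs) = Suc n" by auto
      then have "XX r z \<in> ?S" by (intro span_base) blast
      with step show ?case by (simp add: act_linear span_add span_scale)
    qed
    then have "lowered \<subseteq> ?S" unfolding lowered_def by (intro span_minimal) auto
    with assms show ?case by auto
  qed
  from this[of v 5] have "v \<in> span {foldr XX rs v | rs v. length rs = 5}" .
  moreover have "{foldr XX rs v | rs v. length rs = 5} \<subseteq> {0}"
    by (auto simp: length_Suc_conv numeral_eq_Suc XX_nilpotent)
  ultimately show ?thesis using span_mono span_zero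
    by (metis (no_types, lifting) singletonD span_insert_0 span_empty subsetD)
qed

inductive_set XX_closure :: "'v set \<Rightarrow> 'v set" for U where
  base: "u \<in> U \<Longrightarrow> u \<in> XX_closure U"
| zero: "0 \<in> XX_closure U"
| add: "v \<in> XX_closure U \<Longrightarrow> w \<in> XX_closure U \<Longrightarrow> v + w \<in> XX_closure U"
| scale: "v \<in> XX_closure U \<Longrightarrow> c *s v \<in> XX_closure U"
| XX: "v \<in> XX_closure U \<Longrightarrow> XX r v \<in> XX_closure U"

lemma XX_closure_uminus: "v \<in> XX_closure U \<Longrightarrow> - v \<in> XX_closure U"
  using XX_closure.scale[of v U "- 1"] by simp

text \<open>
  The cross relations move every \<open>y\<close> past the \<open>x\<close>'s, at the price of terms from \<open>D(S\<^sub>3)\<close>.  Hence a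
  \<open>D(S\<^sub>3)\<close>-stable set \<open>U\<close> of vectors killed by all \<open>y\<close> generates the submodule obtained by applying
  only \<open>x\<close>'s to it.
\<close>

lemma XX_closure_submodule:
  assumes RR: "\<And>t u. u \<in> U \<Longrightarrow> RR t u \<in> U" and DD: "\<And>g u. u \<in> U \<Longrightarrow> DD g u \<in> U"
    and YY: "\<And>t u. u \<in> U \<Longrightarrow> YY t u = 0"
  shows "D_submodule (XX_closure U)"
proof (rule D_submoduleI)
  show "subspace (XX_closure U)"
    by (simp add: subspace_def XX_closure.zero XX_closure.add XX_closure.scale)
  show RR': "RR t u \<in> XX_closure U" if "u \<in> XX_closure U" for t u
    using that by induction
      (auto simp: act_linear RR_XX intro: XX_closure.intros XX_closure_uminus RR)
  show DD': "DD g u \<in> XX_closure U" if "u \<in> XX_closure U" for g u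
    using that by (induction arbitrary: g)
      (auto simp: act_linear DD_XX intro: XX_closure.intros DD)
  show "YY t u \<in> XX_closure U" if "u \<in> XX_closure U" for t u
    using that
  proof (induction arbitrary: t)
    case (XX v r)
    have "- w \<in> XX_closure U" if "w \<in> XX_closure U" for w using that by (rule XX_closure_uminus)
    then show ?case using XX RR' DD' unfolding cross[of t r v] diff_conv_add_uminus
      by (intro XX_closure.add) (auto intro: XX_closure.XX XX_closure.zero)
  qed (auto simp: act_linear YY intro: XX_closure.intros)
  show "XX t u \<in> XX_closure U" if "u \<in> XX_closure U" for t u
    using that by (rule XX_closure.XX)
qed

text \<open>
  The singular vectors in \<open>V M\<close> are stable under \<open>D(S\<^sub>3)\<close>, so the submodule that they generate is obtained
  by applying \<open>x\<close>'s and stays inside \<open>V M\<close>.  This is a proper subspace, so if \<open>M\<close> is simple the submodule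
  is zero.  The argument does the work of a \<open>\<int>\<close>-grading, which a module of the double does not carry a
  priori.
\<close>

lemma simple_singular:
  assumes simple: simple_D_module and v: "v \<in> lowered" "\<And>s. YY s v = 0"
  shows "v = 0"
proof -
  define U where "U = {v \<in> lowered. \<forall>s. YY s v = 0}"
  have sub: "subspace lowered" by (simp add: lowered_def)
  have lin: "RR t u \<in> lowered" "DD g u \<in> lowered" if "u \<in> lowered" for t g u
    using that unfolding lowered_def
    by (induction rule: span_induct_alt)
      (auto simp: act_linear RR_XX DD_XX XX_lowered[unfolded lowered_def]
        intro!: span_add span_scale span_zero span_neg)
  have "D_submodule (XX_closure U)"
  proof (rule XX_closure_submodule)
    fix t u assume u: "u \<in> U"
    have "RR t (YY s (RR t u)) = 0" for s using u by (simp add: RR_YY U_def)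
    then have "YY s (RR t u) = 0" for s using RR_RR[of t "YY s (RR t u)"] by simp
    then show "RR t u \<in> U" using u lin by (simp add: U_def)
    show "YY t u = 0" using u by (simp add: U_def)
  next
    fix g u assume u: "u \<in> U"
    have "YY s (DD g u) = DD (perm_of s * g) (YY s u)" for s
      by (simp add: DD_YY perm_of_square flip: mult.assoc)
    then show "DD g u \<in> U" using u lin by (simp add: U_def)
  qed
  moreover have "XX_closure U \<subseteq> lowered"
  proof
    fix w assume "w \<in> XX_closure U" then show "w \<in> lowered"
      by induction (auto simp: U_def XX_lowered sub subspace_0 subspace_add subspace_scale)
  qed
  moreover have "lowered \<noteq> UNIV"
    using simple lowered_proper unfolding simple_D_module_def by auto
  ultimately have "XX_closure U = {0}"
    using simple unfolding simple_D_module_def by auto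
  then show ?thesis using v XX_closure.base[of v U] by (simp add: U_def)
qed


section \<open>Graded subspaces given by spanning sets\<close>

text \<open>
  An \<open>S\<^sub>3\<close>-graded subspace is prescribed by spanning sets of its homogeneous components: \<open>K\<close> in degree \<open>1\<close>,
  \<open>U\<close> in degree \<open>(123)\<close>, \<open>W\<close> in degree \<open>(132)\<close> and \<open>S r\<close> in degree \<open>r\<close>.  Describing the subspace through the
  components of its elements, and not as a span, gives direct access to these components later.
\<close>

definition component :: "'v set \<Rightarrow> 'v set \<Rightarrow> 'v set \<Rightarrow> (transposition \<Rightarrow> 'v set) \<Rightarrow> S3 \<Rightarrow> 'v set" where
  "component K U W S g = span (if g = 1 then K else if g = rot then U else if g = rot' then W
     else S (inv perm_of g))"

definition graded_span :: "'v set \<Rightarrow> 'v set \<Rightarrow> 'v set \<Rightarrow> (transposition \<Rightarrow> 'v set) \<Rightarrow> 'v set" where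
  "graded_span K U W S = {z. \<forall>g. DD g z \<in> component K U W S g}"

lemma component_simps [simp]:
  "component K U W S 1 = span K" "component K U W S rot = span U" "component K U W S rot' = span W"
  "component K U W S (perm_of r) = span (S r)"
  by (simp_all add: component_def inj_perm_of)

lemma graded_span_component: "z \<in> graded_span K U W S \<Longrightarrow> DD g z \<in> component K U W S g"
  by (simp add: graded_span_def)

lemma subspace_component: "subspace (component K U W S g)"
  by (simp add: component_def)

lemma act_span:
  assumes "v \<in> span A" "\<And>a. a \<in> A \<Longrightarrow> d \<cdot> a \<in> span B"
  shows "d \<cdot> v \<in> span B"
  using assms(1) by (induction rule: span_induct_alt)
    (auto simp: act_linear intro!: span_zero span_add span_scale assms(2))

text \<open>
  The target of each condition is forced: \<open>x\<^sub>t\<close> and \<open>y\<^sub>t\<close> multiply the degree by \<open>t\<close> from the left, and \<open>t\<close>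
  itself conjugates it.
\<close>

lemma graded_span_submodule:
  assumes K: "\<And>k t. k \<in> K \<Longrightarrow> RR t k \<in> span K \<and> XX t k \<in> span (S t) \<and> YY t k \<in> span (S t)"
    and U: "\<And>u t. u \<in> U \<Longrightarrow> RR t u \<in> span W \<and> XX t u \<in> span (S (nxt t)) \<and> YY t u \<in> span (S (nxt t))"
    and W: "\<And>w t. w \<in> W \<Longrightarrow> RR t w \<in> span U \<and> XX t w \<in> span (S (prv t)) \<and> YY t w \<in> span (S (prv t))"
    and S1: "\<And>r s t. s \<in> S r \<Longrightarrow> RR t s \<in> span (S (reflect t r))"
    and S2: "\<And>t s. s \<in> S t \<Longrightarrow> XX t s \<in> span K \<and> YY t s \<in> span K"
    and S3: "\<And>t s. s \<in> S (nxt t) \<Longrightarrow> XX t s \<in> span U \<and> YY t s \<in> span U"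
    and S4: "\<And>t s. s \<in> S (prv t) \<Longrightarrow> XX t s \<in> span W \<and> YY t s \<in> span W"
  shows "D_submodule (graded_span K U W S)"
proof -
  let ?F = "component K U W S"
  have RR: "RR t v \<in> ?F (perm_of t * g * perm_of t)" if "v \<in> ?F g" for g v t
  proof -
    consider "g = 1" | "g = rot" | "g = rot'" | r where "g = perm_of r"
      using S3_exhaust[of g] by metis
    then show ?thesis
      using that K U W S1
      by cases (auto simp: perm_of_square rot_conj perm_of_conj elim!: act_span)
  qed
  have XY: "XX t v \<in> ?F (perm_of t * g) \<and> YY t v \<in> ?F (perm_of t * g)" if "v \<in> ?F g" for g v t
  proof -
    consider "g = 1" | "g = rot" | "g = rot'" | "g = perm_of t" | "g = perm_of (nxt t)" | "g = perm_of (prv t)"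
      using S3_exhaust[of g] transposition_cases by metis
    then show ?thesis
      using that K U W S2 S3 S4
      by cases (auto simp: perm_of_mult perm_of_mult_rot elim!: act_span)
  qed
  show ?thesis
  proof (rule D_submoduleI)
    show "subspace (graded_span K U W S)"
      using subspace_component unfolding subspace_def graded_span_def by (auto simp: act_linear)
    show "RR t z \<in> graded_span K U W S" if "z \<in> graded_span K U W S" for t z
    proof -
      have "DD g (RR t z) \<in> ?F g" for g
      proof -
        have "perm_of t * (perm_of t * g * perm_of t) * perm_of t = g"
          by (metis mult.assoc mult_1_left mult_1_right perm_of_square)
        then show ?thesis
          using RR[OF graded_span_component[OF that, of "perm_of t * g * perm_of t"], of t]
          by (simp add: RR_DD)
      qed
      then show ?thesis by (simp add: graded_span_def)
    qed
    have tt: "perm_of t * (perm_of t * g) = g" for t g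
      by (simp add: perm_of_square flip: mult.assoc)
    show "XX t z \<in> graded_span K U W S" "YY t z \<in> graded_span K U W S" if "z \<in> graded_span K U W S" for t z
      using XY[OF graded_span_component[OF that], of t] tt
      unfolding graded_span_def DD_XX DD_YY mem_Collect_eq by metis+
    show "DD h z \<in> graded_span K U W S" if "z \<in> graded_span K U W S" for h z
      using that subspace_0[OF subspace_component] by (simp add: graded_span_def DD_DD)
  qed
qed

lemma mem_graded_span:
  assumes "has_degree g v" "v \<in> component K U W S g"
  shows "v \<in> graded_span K U W S"
  using assms subspace_0[OF subspace_component] by (simp add: graded_span_def DD_deg)

lemma submodule_homogeneous:
  assumes "D_submodule N" "N \<noteq> {0}"
  obtains g v where "v \<in> N" "v \<noteq> 0" "has_degree g v"
proof -
  from assms obtain z where z: "z \<in> N" "z \<noteq> 0"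
    unfolding D_submodule_def using subspace_0 by blast
  then obtain g where "DD g z \<noteq> 0" using DD_sum[of z] by (metis sum.neutral)
  moreover have "DD g z \<in> N" using assms(1) z by (simp add: D_submodule_def)
  ultimately show thesis using deg_DD that by blast
qed

end


section \<open>Copies of the weights and types of modules\<close>

locale char0_D_module = D_module scale act
  for scale :: "'k::field_char_0 \<Rightarrow> 'v::ab_group_add \<Rightarrow> 'v" (infixr \<open>*s\<close> 75)
    and act :: "'k double \<Rightarrow> 'v \<Rightarrow> 'v" (infixr \<open>\<cdot>\<close> 75)
begin

lemma scale_numeral_2: "(2::'k) *s v = v + v"
  by (metis one_add_one scale_left_distrib scale_one)

lemma double_eq_0: "v + v = 0 \<Longrightarrow> (v :: 'v) = 0"
  by (metis scale_numeral_2 scale_eq_0_iff zero_neq_numeral)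

lemma triple_eq_0: assumes "v + v + v = 0" shows "(v :: 'v) = 0"
proof -
  have "(2 + 1) *s v = 0" using assms by (simp only: scale_left_distrib scale_numeral_2 scale_one)
  then have "(3::'k) = 0 \<or> v = 0" by (simp only: scale_eq_0_iff numeral_3_eq_3) simp
  then show ?thesis by simp
qed

lemma halve: "a + a = b \<Longrightarrow> a = (1/2) *s (b :: 'v)"
  by (auto simp: scale_numeral_2[symmetric])

lemma mem_scaled: "subspace U \<Longrightarrow> c *s v \<in> U \<Longrightarrow> c \<noteq> 0 \<Longrightarrow> v \<in> U"
  using subspace_scale[of U "c *s v" "inverse c"] by simp

lemma mem_double: "subspace U \<Longrightarrow> v + v \<in> U \<Longrightarrow> v \<in> U"
  using mem_scaled[of U 2 v] by (simp add: scale_numeral_2)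

definition trivial_vector :: "'v \<Rightarrow> bool" where
  "trivial_vector v \<longleftrightarrow> has_degree 1 v \<and> (\<forall>t. RR t v = v)"

text \<open>
  Such vectors span a copy of \<open>(e,\<rho>)\<close>, unless they are all zero: \<open>k\<^sub>r\<close> is the eigenvector of \<open>r\<close> for \<open>-1\<close>, normalised so
  that \<open>S\<^sub>3\<close> permutes the three vectors up to the sign character.  Three dependent vectors instead of a basis keep
  the symmetry.
\<close>

definition rho_family :: "(transposition \<Rightarrow> 'v) \<Rightarrow> bool" where
  "rho_family k \<longleftrightarrow> (\<forall>r. has_degree 1 (k r)) \<and> (\<forall>t r. RR t (k r) = - k (reflect t r)) \<and>
     k T12 + k T13 + k T23 = 0"

text \<open>
  The standard basis of \<open>(\<tau>,0)\<close>, or two zero vectors.  Since all transpositions act in the same way, the rotations act trivially.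
\<close>

definition tau_pair :: "'v \<Rightarrow> 'v \<Rightarrow> bool" where
  "tau_pair u w \<longleftrightarrow> has_degree rot u \<and> has_degree rot' w \<and> (\<forall>t. RR t u = w \<and> RR t w = u)"

text \<open>
  The standard basis of \<open>(\<sigma>,-)\<close>, or three zero vectors.
\<close>

definition sigma_family :: "(transposition \<Rightarrow> 'v) \<Rightarrow> bool" where
  "sigma_family b \<longleftrightarrow> (\<forall>r. has_degree (perm_of r) (b r)) \<and> (\<forall>t r. RR t (b r) = - b (reflect t r))"

text \<open>
  No weights other than \<open>\<epsilon>\<close>, \<open>(e,\<rho>)\<close>, \<open>(\<sigma>,+)\<close> and \<open>(\<tau>,0)\<close> occur: the three conditions exclude \<open>(\<sigma>,-)\<close>, then
  \<open>(e,-)\<close>, then \<open>(\<tau>,1)\<close> and \<open>(\<tau>,2)\<close>.  The name refers to the highest weights \<open>\<epsilon>\<close>, \<open>(e,\<rho>)\<close>, \<open>(\<tau>,0)\<close>, which have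
  even permutations as degrees.
\<close>

definition even_type :: bool where
  "even_type \<longleftrightarrow> (\<forall>r v. has_degree (perm_of r) v \<longrightarrow> RR r v = v) \<and>
     (\<forall>v. has_degree 1 v \<longrightarrow> (\<forall>t. RR t v = - v) \<longrightarrow> v = 0) \<and>
     (\<forall>v. has_degree rot v \<longrightarrow> dgen (Grp rot) \<cdot> v = v)"

text \<open>
  No weights other than \<open>(\<sigma>,-)\<close>, \<open>(\<tau>,1)\<close> and \<open>(\<tau>,2)\<close> occur: the three conditions exclude \<open>(\<sigma>,+)\<close>, then all weights
  of degree \<open>e\<close>, then \<open>(\<tau>,0)\<close>.
\<close>

definition odd_type :: bool where
  "odd_type \<longleftrightarrow> (\<forall>r v. has_degree (perm_of r) v \<longrightarrow> RR r v = - v) \<and>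
     (\<forall>v. has_degree 1 v \<longrightarrow> v = 0) \<and>
     (\<forall>v. has_degree rot v \<longrightarrow> v + dgen (Grp rot) \<cdot> v + dgen (Grp rot) \<cdot> dgen (Grp rot) \<cdot> v = 0)"

lemma even_typeD:
  assumes even_type
  shows "has_degree (perm_of r) v \<Longrightarrow> RR r v = v"
    and "has_degree 1 v \<Longrightarrow> (\<And>t. RR t v = - v) \<Longrightarrow> v = 0"
    and "has_degree rot v \<Longrightarrow> dgen (Grp rot) \<cdot> v = v"
  using assms unfolding even_type_def by blast+

lemma odd_typeD:
  assumes odd_type
  shows "has_degree (perm_of r) v \<Longrightarrow> RR r v = - v"
    and "has_degree 1 v \<Longrightarrow> v = 0"
    and "has_degree rot v \<Longrightarrow> v + dgen (Grp rot) \<cdot> v + dgen (Grp rot) \<cdot> dgen (Grp rot) \<cdot> v = 0"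
  using assms unfolding odd_type_def by blast+

lemma rho_familyD:
  assumes "rho_family k"
  shows "has_degree 1 (k r)" "RR t (k r) = - k (reflect t r)" "k r + k (nxt r) + k (prv r) = 0"
  using assms unfolding rho_family_def by (auto, cases r, auto simp: ac_simps)

text \<open>
  On \<open>\<rho>\<close> a transposition has the simple eigenvalues \<open>1\<close> and \<open>-1\<close>, and \<open>1 - r\<close> projects onto the eigenspace of the second
  up to a factor.  The sum of the transpositions is central in the group algebra and acts on an irreducible representation
  by a multiple of its character value at a transposition, which is \<open>0\<close> for \<open>\<rho>\<close>.
\<close>

lemma rho_family_antisym:
  assumes k: "rho_family k" and "v \<in> span (range k)"
  shows "v - RR r v \<in> span {k r}" "RR T12 v + RR T13 v + RR T23 v = 0"
proof -
  show "v - RR r v \<in> span {k r}"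
    using assms(2)
  proof (induction rule: span_induct_alt)
    case base show ?case by (simp add: span_zero)
  next
    case (step c x y)
    then obtain q where x: "x = k q" by auto
    have "k q + k (reflect r q) = (if q = r then k r + k r else - k r)"
      using rho_familyD(3)[OF k, of r] transposition_cases[of q r]
      by (auto simp: eq_neg_iff_add_eq_0 algebra_simps)
    then have "x - RR r x \<in> span {k r}"
      by (simp add: x rho_familyD(2)[OF k] span_base span_add span_neg)
    then have "c *s (x - RR r x) + (y - RR r y) \<in> span {k r}"
      using step by (intro span_add span_scale)
    then show ?case by (simp add: act_linear algebra_simps)
  qed
  show "RR T12 v + RR T13 v + RR T23 v = 0"
    using assms(2)
  proof (induction rule: span_induct_alt)
    case (step c x y)
    then obtain q where x: "x = k q" by auto
    have "RR T12 x + RR T13 x + RR T23 x = 0"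
      using rho_familyD(3)[OF k, of T12] by (cases q)
       (simp_all add: x rho_familyD(2)[OF k] reflect_def eq_neg_iff_add_eq_0 neg_eq_iff_add_eq_0 algebra_simps)
    then have "c *s (RR T12 x + RR T13 x + RR T23 x) + (RR T12 y + RR T13 y + RR T23 y) = 0"
      using step by simp
    then show ?case by (simp only: act_linear scale_right_distrib ac_simps)
  qed simp
qed

text \<open>
  Irreducibility of \<open>\<rho>\<close>: if all transpositions fixed \<open>v\<close>, their sum would act as \<open>3\<close> and not as \<open>0\<close>; and if \<open>r\<close>
  moves \<open>v\<close>, then \<open>v - r v\<close> is a nonzero multiple of \<open>k\<^sub>r\<close>.
\<close>

lemma rho_family_submodule:
  assumes k: "rho_family k" and U: "D_submodule U" and v: "v \<in> U" "v \<in> span (range k)" "v \<noteq> 0"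
  shows "k q \<in> U"
proof -
  have sub: "subspace U" and act: "\<And>d u. u \<in> U \<Longrightarrow> d \<cdot> u \<in> U"
    using U by (auto simp: D_submodule_def)
  have "\<exists>r. RR r v \<noteq> v"
  proof (rule ccontr)
    assume "\<not> ?thesis"
    then have "v + v + v = 0" using rho_family_antisym(2)[OF k v(2)] by simp
    with v(3) triple_eq_0 show False by blast
  qed
  then obtain r c where c: "v - RR r v = c *s k r" "RR r v \<noteq> v"
    using rho_family_antisym(1)[OF k v(2)] unfolding span_singleton by blast
  moreover have "v - RR r v \<in> U" using sub act v(1) by (simp add: subspace_diff)
  ultimately have kr: "k r \<in> U" using mem_scaled[OF sub, of c "k r"] by (cases "c = 0") auto
  obtain t where "reflect t r = q" using transposition_cases[of q r] reflect_simps by metis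
  then have "- k q \<in> U"
    using act[OF kr, of "dgen (Grp (perm_of t))"] by (simp add: rho_familyD(2)[OF k])
  from subspace_neg[OF sub this] show ?thesis by simp
qed

text \<open>
  The hypotheses describe a module with \<open>(e,\<rho>)\<close> in degree \<open>e\<close>, \<open>(\<sigma>,+)\<close> in the degrees of the transpositions and
  \<open>(\<tau>,0)\<close> in the degrees of the rotations.  In the applications \<open>u'\<close> is \<open>w\<close> or \<open>- w\<close>.
\<close>

lemma even_typeI:
  assumes "graded_span (range k) {u} {w} (\<lambda>r. {s r}) = UNIV"
    and "rho_family k" "\<And>r. RR r (s r) = s r" "\<And>t. RR t u = u' \<and> RR t u' = u"
  shows even_type
proof -
  have comp: "v \<in> component (range k) {u} {w} (\<lambda>r. {s r}) g" if "has_degree g v" for g v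
    using graded_span_component[of v] assms(1) that unfolding has_degree_def by (metis UNIV_I)
  show ?thesis unfolding even_type_def
  proof (intro conjI allI impI)
    fix r v assume "has_degree (perm_of r) v"
    from comp[OF this] show "RR r v = v" using assms(3) by (auto simp: span_singleton act_scale)
  next
    fix v assume "has_degree 1 v" and v: "\<forall>t. RR t v = - v"
    from comp[OF this(1)] have "- v - v - v = 0" using rho_family_antisym(2)[OF assms(2), of v] v by simp
    then show "v = 0" using triple_eq_0[of "- v"] by simp
  next
    fix v assume "has_degree rot v"
    from comp[OF this] show "dgen (Grp rot) \<cdot> v = v"
      using assms(4) by (auto simp: span_singleton act_scale RR_cycle(1)[of T12, symmetric])
  qed
qed

lemma DD_component:
  assumes "U \<subseteq> graded_span K V W S" "v \<in> U" "has_degree g v"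
  shows "v \<in> component K V W S g"
  using assms graded_span_component[of v K V W S g] unfolding has_degree_def by auto


section \<open>The module with highest weight rho\<close>

text \<open>
  Starting from a copy of \<open>(e,\<rho>)\<close> killed by all \<open>y\<close>, the vectors \<open>s\<^sub>r = x\<^sub>r k\<^sub>r\<close> span a copy of \<open>(\<sigma>,+)\<close>, and \<open>x\<^sub>t s\<^sub>q\<close> with
  \<open>q \<noteq> t\<close> depends only on the rotation \<open>t q\<close>, giving a copy of \<open>(\<tau>,0)\<close>.  These three span a copy of \<open>L(e,\<rho>)\<close>, with
  the weights in \<open>\<int>\<close>-degrees \<open>0, -1, -2\<close>.  The third hypothesis says that the copy of \<open>(\<sigma>,-)\<close> in \<open>V \<otimes> \<rho>\<close> is mapped to
  zero.
\<close>

context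
  fixes k assumes k: "rho_family k" and yk: "\<And>t r. YY t (k r) = 0"
    and xk: "\<And>r. XX r (k (nxt r)) = XX r (k (prv r))"
begin

private abbreviation "s r \<equiv> XX r (k r)"

definition rho_span where
  "rho_span = graded_span (range k) {XX T12 (XX T23 (k T23))} {XX T12 (XX T13 (k T13))} (\<lambda>r. {XX r (k r)})"

text \<open>
  As \<open>x\<^sub>r\<close> agrees on the two vectors \<open>k\<^sub>q\<close> with \<open>q \<noteq> r\<close>, whose sum is \<open>- k\<^sub>r\<close>, it maps each of them to \<open>- s\<^sub>r / 2\<close>.
\<close>

lemma rho_XX_half: "q \<noteq> r \<Longrightarrow> XX r (k q) + XX r (k q) = - s r"
  using rho_familyD(3)[OF k, of r, THEN arg_cong[of _ _ "XX r"]] xk[of r] transposition_cases[of q r]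
  by (auto simp: act_add_right eq_neg_iff_add_eq_0 algebra_simps)

text \<open>
  Let \<open>a, b, c\<close> be the three vectors \<open>x\<^sub>t s\<^sub>q\<close> with a fixed rotation \<open>t q\<close>.  The quadratic relation applied to the
  three vectors \<open>k\<^sub>q\<close> reads \<open>2a = b + c\<close>, \<open>2b = a + c\<close>, \<open>2c = a + b\<close>, so \<open>a = b = c\<close>.
\<close>

lemma rho_XX_XX: "XX t (s (nxt t)) = XX T12 (s T23)" "XX t (s (prv t)) = XX T12 (s T13)"
proof -
  have nich: "XX t (XX (prv t) (k q + k q)) + XX (nxt t) (XX t (k q + k q)) + XX (prv t) (XX (nxt t) (k q + k q)) = 0"
    "XX t (XX (nxt t) (k q + k q)) + XX (nxt t) (XX (prv t) (k q + k q)) + XX (prv t) (XX t (k q + k q)) = 0" for t q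
    by (rule XX_nichols)+
  (* doubling k_q avoids the fraction 1/2 *)
  have x2: "XX r (k q + k q) = (if q = r then s r + s r else - s r)" for r q
    using rho_XX_half by (simp add: act_add_right)
  have eq: "a = b" if "(a + a) + - b + - c = 0" "- a + (b + b) + - c = 0" for a b c :: 'v
  proof -
    have "a + a - b = c" "b + b - a = c" using that by (simp_all add: algebra_simps)
    moreover have "(a - b) + (a - b) + (a - b) = (a + a - b) - (b + b - a)" by (simp add: algebra_simps)
    ultimately show ?thesis using triple_eq_0[of "a - b"] by simp
  qed
  have 1: "XX t (s (prv t)) = XX (nxt t) (s t)" for t
  proof (rule eq)
    show "XX t (s (prv t)) + XX t (s (prv t)) + - XX (nxt t) (s t) + - XX (prv t) (s (nxt t)) = 0"
      using nich(1)[of t "prv t"] unfolding x2 by (simp only: act_add_right act_uminus_right nxt_prv simp_thms if_True if_False)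
    show "- XX t (s (prv t)) + (XX (nxt t) (s t) + XX (nxt t) (s t)) + - XX (prv t) (s (nxt t)) = 0"
      using nich(1)[of t t] unfolding x2 by (simp only: act_add_right act_uminus_right nxt_prv simp_thms if_True if_False)
  qed
  have 2: "XX t (s (nxt t)) = XX (nxt t) (s (prv t))" for t
  proof (rule eq)
    show "XX t (s (nxt t)) + XX t (s (nxt t)) + - XX (nxt t) (s (prv t)) + - XX (prv t) (s t) = 0"
      using nich(2)[of t "nxt t"] unfolding x2 by (simp only: act_add_right act_uminus_right nxt_prv simp_thms if_True if_False)
    show "- XX t (s (nxt t)) + (XX (nxt t) (s (prv t)) + XX (nxt t) (s (prv t))) + - XX (prv t) (s t) = 0"
      using nich(2)[of t "prv t"] unfolding x2 by (simp only: act_add_right act_uminus_right nxt_prv simp_thms if_True if_False)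
  qed
  show "XX t (s (nxt t)) = XX T12 (s T23)" "XX t (s (prv t)) = XX T12 (s T13)"
    using 1[of T12] 1[of T23] 1[of T13] 2[of T12] 2[of T23] 2[of T13] by (cases t; simp)+
qed

lemma rho_YY_s: "YY t (s r) = (if t = r then k r + k r else 0)"
  by (simp add: cross_deg_1[OF rho_familyD(1)[OF k]] rho_familyD(2)[OF k] yk)

lemma deg_rho_s: "has_degree (perm_of r) (s r)"
  by (intro deg_shift rho_familyD[OF k])

lemma rho_YY_u: "YY t (XX T12 (s T23)) = s (nxt t)"
  unfolding rho_XX_XX(1)[of t, symmetric]
  by (simp add: cross_deg_perm_of[OF deg_rho_s] rho_YY_s)

lemma rho_YY_w: "YY t (XX T12 (s T13)) = s (prv t)"
  unfolding rho_XX_XX(2)[of t, symmetric]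
  by (simp add: cross_deg_perm_of[OF deg_rho_s] rho_YY_s)

lemma rho_RR_s: "RR t (s r) = s (reflect t r)"
  by (simp add: RR_XX rho_familyD(2)[OF k])

lemma rho_RR_u: "RR t (XX T12 (s T23)) = - XX T12 (s T13)"
  and rho_RR_w: "RR t (XX T12 (s T13)) = - XX T12 (s T23)"
  unfolding rho_XX_XX[of t, symmetric] by (simp_all add: RR_XX rho_familyD(2)[OF k])

lemma rho_submodule: "D_submodule rho_span"
  unfolding rho_span_def
proof (rule graded_span_submodule)
  fix v t assume "v \<in> range k"
  then obtain q where v: "v = k q" by auto
  have "XX t (k q) = (if q = t then s t else - ((1/2) *s s t))"
    using halve[OF rho_XX_half] by auto
  then show "RR t v \<in> span (range k) \<and> XX t v \<in> span {XX t (k t)} \<and> YY t v \<in> span {XX t (k t)}"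
    by (simp add: v rho_familyD(2)[OF k] yk span_base span_neg span_scale span_zero)
next
  fix u t assume "u \<in> {XX T12 (XX T23 (k T23))}"
  moreover have "XX t (XX T12 (XX T23 (k T23))) = 0"
    unfolding rho_XX_XX(1)[of t, symmetric] by simp
  ultimately show "RR t u \<in> span {XX T12 (XX T13 (k T13))} \<and> XX t u \<in> span {XX (nxt t) (k (nxt t))} \<and>
      YY t u \<in> span {XX (nxt t) (k (nxt t))}"
    by (simp add: rho_RR_u rho_YY_u span_base span_neg span_zero)
next
  fix u t assume "u \<in> {XX T12 (XX T13 (k T13))}"
  moreover have "XX t (XX T12 (XX T13 (k T13))) = 0"
    unfolding rho_XX_XX(2)[of t, symmetric] by simp
  ultimately show "RR t u \<in> span {XX T12 (XX T23 (k T23))} \<and> XX t u \<in> span {XX (prv t) (k (prv t))} \<and>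
      YY t u \<in> span {XX (prv t) (k (prv t))}"
    by (simp add: rho_RR_w rho_YY_w span_base span_neg span_zero)
qed (auto simp: rho_RR_s rho_YY_s rho_XX_XX intro!: span_add span_zero intro: span_base)

lemma rho_mem: "k r \<in> rho_span"
  unfolding rho_span_def by (rule mem_graded_span[OF rho_familyD(1)[OF k]]) (simp add: span_base)

text \<open>
  From each degree the \<open>y\<close>'s lead back to the top: \<open>y\<^sub>t\<close> maps the vector of degree \<open>(123)\<close> to \<open>s\<close> with index \<open>nxt t\<close>,
  that of degree \<open>(132)\<close> to \<open>s\<close> with index \<open>prv t\<close>, and \<open>y\<^sub>r s\<^sub>r = 2 k\<^sub>r\<close>.
\<close>

lemma rho_simple:
  assumes U: "D_submodule U" "U \<subseteq> rho_span" "U \<noteq> {0}"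
  shows "k q \<in> U"
proof -
  have sub: "subspace U" and act: "\<And>d u. u \<in> U \<Longrightarrow> d \<cdot> u \<in> U"
    using U by (auto simp: D_submodule_def)
  have k0: "k q \<in> U" if "v \<in> U" "v \<in> span (range k)" "v \<noteq> 0" for v
    using rho_family_submodule[OF k U(1) that] .
  obtain g v where v: "v \<in> U" "v \<noteq> 0" "has_degree g v" using submodule_homogeneous[OF U(1,3)] .
  have comp: "v \<in> component (range k) {XX T12 (XX T23 (k T23))} {XX T12 (XX T13 (k T13))} (\<lambda>r. {XX r (k r)}) g"
    using DD_component[OF U(2)[unfolded rho_span_def] v(1,3)] .
  have s0: "k q \<in> U" if "s r \<in> U" "s r \<noteq> 0" for r
  proof (rule k0)
    show "k r \<in> U" using act[OF that(1), of "dgen (Y r)"] mem_double[OF sub, of "k r"] by (simp add: rho_YY_s)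
    show "k r \<in> span (range k)" by (simp add: span_base)
    show "k r \<noteq> 0" using that(2) by auto
  qed
  have u0: "k q \<in> U" if "z \<in> U" "z \<noteq> 0" "z = c *s a" "YY T12 a = s r" "a = XX p (s r)" for z c a r p
  proof -
    have "a \<in> U" using that mem_scaled[OF sub, of c a] by fastforce
    then have "s r \<in> U" using act[of a "dgen (Y T12)"] that(4) by simp
    moreover have "s r \<noteq> 0" using that by auto
    ultimately show ?thesis by (rule s0)
  qed
  consider "g = 1" | "g = rot" | "g = rot'" | r where "g = perm_of r"
    using S3_exhaust[of g] by metis
  then show ?thesis
  proof cases
    case 1
    then show ?thesis using comp k0[OF v(1) _ v(2)] by simp
  next
    case 2
    with comp obtain c where c: "v = c *s XX T12 (s T23)" by (auto simp: span_singleton)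
    show ?thesis by (rule u0[OF v(1,2) c _ refl]) (simp add: rho_YY_u)
  next
    case 3
    with comp obtain c where c: "v = c *s XX T12 (s T13)" by (auto simp: span_singleton)
    show ?thesis by (rule u0[OF v(1,2) c _ refl]) (simp add: rho_YY_w)
  next
    case 4
    with comp obtain c where c: "v = c *s s r" by (auto simp: span_singleton)
    then have "s r \<in> U" "s r \<noteq> 0" using v mem_scaled[OF sub, of c "s r"] by fastforce+
    then show ?thesis by (rule s0)
  qed
qed

lemma rho_even_type: "rho_span = UNIV \<Longrightarrow> even_type"
  unfolding rho_span_def
  by (erule even_typeI[OF _ k, where u' = "- XX T12 (s T13)"]) (simp_all add: rho_RR_s rho_RR_u rho_RR_w)

end


section \<open>The module with highest weight tau\<close>

text \<open>
  Starting from a copy of \<open>(\<tau>,0)\<close> killed by all \<open>y\<close>, the vectors \<open>x\<^sub>r u\<close> and \<open>x\<^sub>r w\<close> give the same three vectors \<open>s\<^sub>q\<close> up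
  to a sign, which kills the copy of \<open>(\<sigma>,-)\<close> in \<open>V \<otimes> (\<tau>,0)\<close>.  The \<open>s\<^sub>q\<close> span a copy of \<open>(\<sigma>,+)\<close>, and the \<open>k\<^sub>q = x\<^sub>q s\<^sub>q\<close> one of
  \<open>(e,\<rho>)\<close>.
\<close>

context
  fixes u w s k
  assumes tau: "tau_pair u w" and yu: "\<And>t. YY t u = 0" "\<And>t. YY t w = 0"
    and xu: "\<And>r. XX r u = s (nxt r)" and xw: "\<And>r. XX r w = - s (prv r)"
    and xs: "\<And>r. XX r (s r) = k r"
begin

private abbreviation "tau_span \<equiv> graded_span (range k) {u} {w} (\<lambda>r. {s r})"

lemma tauD: "has_degree rot u" "has_degree rot' w" "RR t u = w" "RR t w = u"
  using tau by (auto simp: tau_pair_def)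

lemma tau_s: "s r = XX (prv r) u" "s r = - XX (nxt r) w"
  using xu[of "prv r"] xw[of "nxt r"] by simp_all

lemma tau_XX_s: "XX t (s r) = (if t = r then k r else 0)"
proof -
  have "XX (prv r) (s r) = 0" by (simp add: tau_s(1))
  moreover have "XX (nxt r) (s r) = 0" by (simp add: tau_s(2))
  ultimately show ?thesis using transposition_cases[of t r] xs by auto
qed

lemma tau_YY_s: "YY t (s r) = (if t = prv r then u else 0) - (if t = nxt r then w else 0)"
  using transposition_cases[of t r]
  by (auto simp: tau_s(1) cross_deg_rot[OF tauD(1)] yu tauD)

lemma deg_tau_s: "has_degree (perm_of r) (s r)"
  using deg_shift(2)[OF tauD(1), of "prv r"] by (simp add: tau_s(1))

lemma tau_RR_s: "RR t (s r) = s (reflect t r)"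
  by (simp add: tau_s(1)[of r] RR_XX tauD xw)

text \<open>
  The sum of the \<open>k\<^sub>r\<close> vanishes because it is a quadratic relation of the Nichols algebra applied to \<open>u\<close>.
\<close>

lemma tau_rho: "rho_family k"
  unfolding rho_family_def
proof (intro conjI allI)
  show "has_degree 1 (k r)" for r using deg_XX_shift(4)[OF deg_tau_s, of r r] by (simp add: xs)
  show "RR t (k r) = - k (reflect t r)" for t r by (simp add: RR_XX tau_RR_s flip: xs)
  show "k T12 + k T13 + k T23 = 0" using XX_nichols(1)[of T12 u] by (simp add: xu xs ac_simps)
qed

lemma tau_YY_k: "YY t (k r) = (if t = r then s r + s r else - s t)"
  using transposition_cases[of t r]
  by (auto simp: cross_deg_perm_of[OF deg_tau_s] tau_RR_s tau_YY_s xu xw simp flip: xs)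

text \<open>
  The braid relation turns \<open>x\<^sub>p x\<^sub>r x\<^sub>p u\<close> with \<open>p = prv r\<close> into \<open>x\<^sub>r x\<^sub>p x\<^sub>r u\<close>, where \<open>x\<^sub>p\<close> kills \<open>x\<^sub>r u = s\<^sub>n\<close> with \<open>n = nxt r\<close>
  since \<open>p \<noteq> n\<close>.  The remaining index follows from the vanishing of the sum of the \<open>k\<^sub>r\<close>.
\<close>

lemma tau_XX_k: "XX t (k r) = 0"
proof -
  have 1: "XX (prv r) (k r) = 0" for r
  proof -
    have "XX (prv r) (k r) = XX (prv r) (XX r (XX (prv r) u))" by (simp add: xu xs)
    also have "\<dots> = XX r (XX (prv r) (XX r u))" by (rule XX_braid)
    finally show ?thesis by (simp add: xu tau_XX_s)
  qed
  have "XX t (k t + k (nxt t) + k (prv t)) = 0"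
    using rho_familyD(3)[OF tau_rho, of t] by simp
  moreover have "XX t (k t) = 0" by (simp flip: xs)
  ultimately have "XX t (k (prv t)) = 0"
    using 1[of "nxt t"] by (simp add: act_add_right)
  then show ?thesis using 1[of r] \<open>XX t (k t) = 0\<close> transposition_cases[of t r] by auto
qed

lemma tau_submodule: "D_submodule tau_span"
  by (rule graded_span_submodule)
    (auto simp: rho_familyD(2)[OF tau_rho] tau_XX_k tau_YY_k tau_RR_s tau_XX_s tau_YY_s tauD xu xw yu
      intro!: span_add span_neg span_zero intro: span_base span_base[OF rangeI])

lemma tau_mem: "u \<in> tau_span"
  by (rule mem_graded_span[OF tauD(1)]) (simp add: span_base)

text \<open>
  Again the \<open>y\<close>'s lead from each degree back to \<open>u\<close>.
\<close>

lemma tau_simple: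
  assumes U: "D_submodule U" "U \<subseteq> tau_span" "U \<noteq> {0}"
  shows "u \<in> U"
proof -
  have sub: "subspace U" and act: "\<And>d v. v \<in> U \<Longrightarrow> d \<cdot> v \<in> U"
    using U by (auto simp: D_submodule_def)
  obtain g v where v: "v \<in> U" "v \<noteq> 0" "has_degree g v" using submodule_homogeneous[OF U(1,3)] .
  have comp: "v \<in> component (range k) {u} {w} (\<lambda>r. {s r}) g"
    using DD_component[OF U(2) v(1,3)] .
  have s0: "u \<in> U" if "s r \<in> U" for r
    using act[OF that, of "dgen (Y (prv r))"] by (simp add: tau_YY_s)
  consider "g = 1" | "g = rot" | "g = rot'" | r where "g = perm_of r"
    using S3_exhaust[of g] by metis
  then show ?thesis
  proof cases
    case 1
    then have "k r \<in> U" for r using comp v rho_family_submodule[OF tau_rho U(1)] by simp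
    then have "s T12 + s T12 \<in> U" using act[of "k T12" "dgen (Y T12)"] by (simp add: tau_YY_k)
    then show ?thesis using mem_double[OF sub] s0 by blast
  next
    case 2
    with comp v show ?thesis using mem_scaled[OF sub] by (auto simp: span_singleton)
  next
    case 3
    with comp v have "w \<in> U" using mem_scaled[OF sub] by (auto simp: span_singleton)
    from act[OF this, of "dgen (Grp (perm_of T12))"] show ?thesis by (simp add: tauD)
  next
    case 4
    with comp v have "s r \<in> U" using mem_scaled[OF sub] by (auto simp: span_singleton)
    then show ?thesis by (rule s0)
  qed
qed

lemma tau_even_type: "tau_span = UNIV \<Longrightarrow> even_type"
  by (erule even_typeI[OF _ tau_rho, where u' = w]) (simp_all add: tau_RR_s tauD)

end


section \<open>The module with highest weight sigma\<close>

lemma sigma_familyD: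
  assumes "sigma_family b"
  shows "has_degree (perm_of r) (b r)" "RR t (b r) = - b (reflect t r)"
  using assms by (auto simp: sigma_family_def)

context
  fixes b
  assumes b: "sigma_family b" and yb: "\<And>t r. YY t (b r) = 0"
begin

lemmas sigmaD = sigma_familyD[OF b]

lemma sigma_YY_XX: "YY t (XX r (b q)) = (if t = r then b q else 0) - (if t = q then b (reflect r q) else 0)"
  by (simp add: cross_deg_perm_of[OF sigmaD(1)] yb sigmaD(2))

text \<open>
  The components \<open>\<epsilon>\<close> and \<open>(e,\<rho>)\<close> of \<open>V \<otimes> (\<sigma>,-)\<close>, spanned by the \<open>x\<^sub>r b\<^sub>r\<close>, and its component \<open>(\<tau>,0)\<close>, spanned by the
  two sums, consist of singular vectors.
\<close>

lemma sigma_singular: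
  "YY t (XX r (b r)) = 0"
  "YY t (XX r (b (nxt r)) + XX (nxt r) (b (prv r)) + XX (prv r) (b r)) = 0"
  "YY t (XX r (b (prv r)) + XX (nxt r) (b r) + XX (prv r) (b (nxt r))) = 0"
  using transposition_cases[of t r] by (auto simp: sigma_YY_XX act_add_right)

text \<open>
  Once these singular vectors are zero, the \<open>f\<^sub>r\<close> and \<open>f'\<^sub>r\<close> span a copy of \<open>(\<tau>,1) \<oplus> (\<tau>,2)\<close> and the \<open>d\<^sub>r\<close> another copy
  of \<open>(\<sigma>,-)\<close>.
\<close>

context
  fixes f f' d
  assumes xb: "\<And>r. XX r (b r) = 0" "\<And>r. XX r (b (nxt r)) = f r" "\<And>r. XX r (b (prv r)) = f' r"
    and sum: "\<And>r. f r + f (nxt r) + f (prv r) = 0" "\<And>r. f' r + f' (nxt r) + f' (prv r) = 0"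
    and d: "\<And>r. XX (prv r) (f r) = d r"
begin

private abbreviation "sigma_span \<equiv> graded_span {} (range f) (range f') (\<lambda>r. {b r, d r})"

lemma deg_sigma_f: "has_degree rot (f r)" "has_degree rot' (f' r)"
  using deg_XX_shift(4)[OF sigmaD(1)[of "nxt r"], of r] deg_XX_shift(4)[OF sigmaD(1)[of "prv r"], of r]
  by (simp_all add: xb)

lemma sigma_RR_f: "RR t (f r) = f' (reflect t r)" "RR t (f' r) = f (reflect t r)"
proof -
  show "RR t (f r) = f' (reflect t r)" unfolding xb(2)[of r, symmetric] xb(3)[symmetric]
    by (simp add: RR_XX sigmaD(2))
  show "RR t (f' r) = f (reflect t r)" unfolding xb(3)[of r, symmetric] xb(2)[symmetric]
    by (simp add: RR_XX sigmaD(2))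
qed

lemma sigma_YY_f:
  "YY t (f r) = (if t = r then b (nxt r) else if t = nxt r then - b (prv r) else 0)"
  "YY t (f' r) = (if t = r then b (prv r) else if t = prv r then - b (nxt r) else 0)"
  unfolding xb(2)[of r, symmetric] xb(3)[of r, symmetric] sigma_YY_XX by auto

lemma sigma_XX_same: "XX r (f r) = 0" "XX r (f' r) = 0"
  unfolding xb(2)[of r, symmetric] xb(3)[of r, symmetric] by simp_all

lemma sigma_XX_f: "XX t (f r) = (if t = r then 0 else if t = prv r then d r else - d (prv r))"
proof -
  have "XX (nxt r) (f r) + XX (nxt r) (f (prv r)) = 0"
    using sum(1)[of r, THEN arg_cong[of _ _ "XX (nxt r)"]] by (simp add: act_add_right sigma_XX_same)
  then have "XX (nxt r) (f r) + d (prv r) = 0" using d[of "prv r"] by simp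
  then show ?thesis using transposition_cases[of t r] d[of r] sigma_XX_same
    by (auto simp: eq_neg_iff_add_eq_0)
qed

lemma sigma_XX_f': "XX t (f' r) = (if t = r then 0 else if t = prv r then - d (nxt r) else d r)"
proof -
  have 1: "XX (prv r) (f' r) + d (nxt r) = 0" for r
  proof -
    have "f' r = XX r (b (prv r))" "f (nxt r) = XX (nxt r) (b (prv r))"
      using xb(2)[of "nxt r"] xb(3)[of r] by simp_all
    then have "XX (prv r) (f' r) + XX r (f (nxt r)) = 0"
      using XX_nichols(2)[of "prv r" "b (prv r)"] by (simp add: xb(1))
    then show ?thesis by (simp add: sigma_XX_f)
  qed
  have "XX (nxt r) (f' r) + XX (nxt r) (f' (prv r)) = 0"
    using sum(2)[of r, THEN arg_cong[of _ _ "XX (nxt r)"]] by (simp add: act_add_right sigma_XX_same)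
  then have "XX (nxt r) (f' r) = d r" using 1[of "prv r"]
    by (metis add.commute add_left_imp_eq nxt_prv(1) nxt_prv(4))
  then show ?thesis using 1[of r] transposition_cases[of t r] sigma_XX_same by (auto simp: eq_neg_iff_add_eq_0)
qed

lemma sigma_RR_d: "RR t (d r) = - d (reflect t r)"
  by (simp add: RR_XX sigma_RR_f sigma_XX_f' flip: d[of r])

lemma deg_sigma_d: "has_degree (perm_of r) (d r)"
  using deg_XX_shift(2)[OF deg_sigma_f(1), of "prv r" r] by (simp add: d)

lemma sigma_YY_d: "YY t (d r) = (if t = r then 0 else if t = prv r then f r else f' r)"
proof -
  have xb': "XX (prv r) (b r) = f (prv r)" "XX (prv r) (b (nxt r)) = f' (prv r)"
    using xb(2)[of "prv r"] xb(3)[of "prv r"] by simp_all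
  have "f' (nxt r) + f' (prv r) + f' r = 0" using sum(2)[of r] by (simp add: ac_simps)
  then have f': "f' r = - f' (nxt r) - f' (prv r)" by (rule sum3_eq_0D)
  have cross: "YY t (d r) = (if t = prv r then f r else 0) - (if t = nxt r then f' (nxt r) else 0)
      - XX (prv r) (YY (reflect (prv r) t) (f r))"
    using cross_deg_rot[OF deg_sigma_f(1)[of r], of t "prv r"] transposition_cases[of t r]
    unfolding d[of r] by (auto simp: sigma_RR_f)
  consider "t = r" | "t = nxt r" | "t = prv r" using transposition_cases[of t r] by blast
  then show ?thesis
  proof cases
    case 1 then show ?thesis unfolding cross by (simp add: sigma_YY_f xb)
  next
    case 2
    then have "YY t (d r) = - f' (nxt r) - f' (prv r)" unfolding cross by (simp add: sigma_YY_f xb')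
    then show ?thesis using 2 f' by simp
  next
    case 3 then show ?thesis unfolding cross by (simp add: sigma_YY_f)
  qed
qed

text \<open>
  The vector \<open>x\<^sub>t d\<^sub>t\<close> has degree \<open>e\<close> and, by the braid relation, does not depend on \<open>t\<close>.  It is the only
  obstruction to the \<open>b\<close>, \<open>f\<close>, \<open>f'\<close>, \<open>d\<close> spanning a submodule, and it is singular.
\<close>

lemma sigma_XX_d: "t \<noteq> r \<Longrightarrow> XX t (d r) = 0" "XX t (d t) = XX q (d q)"
proof -
  have d': "d r = XX (nxt r) (f' r)" for r by (simp add: sigma_XX_f')
  have "XX (nxt r) (d r) = 0" unfolding d'[of r] by simp
  moreover have "XX (prv r) (d r) = 0" unfolding d[of r, symmetric] by simp
  ultimately show "XX t (d r) = 0" if "t \<noteq> r" using transposition_cases[of t r] that by auto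
  have *: "XX r (d r) = XX (nxt r) (d (nxt r))" for r
  proof -
    have "XX r (d r) = XX r (XX (nxt r) (XX r (b (prv r))))" by (simp add: d' xb)
    also have "\<dots> = XX (nxt r) (XX r (XX (nxt r) (b (prv r))))" by (rule XX_braid)
    also have "\<dots> = XX (nxt r) (d (nxt r))" using xb(2)[of "nxt r"] d[of "nxt r"] by simp
    finally show ?thesis .
  qed
  show "XX t (d t) = XX q (d q)"
    using *[of T12] *[of T23] by (cases t; cases q) simp_all
qed

lemma sigma_singular_cubic: "YY t (XX q (d q)) = 0"
proof -
  have "YY t (XX t (d t)) = 0"
    unfolding cross_deg_perm_of[OF deg_sigma_d] by (simp add: sigma_RR_d sigma_YY_d)
  then show ?thesis by (simp only: sigma_XX_d(2)[of q t])
qed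

lemma sigma_submodule:
  assumes "XX T12 (d T12) = 0"
  shows "D_submodule sigma_span"
proof -
  have xd: "XX t (d r) = 0" for t r
    using sigma_XX_d(1)[of t r] sigma_XX_d(2)[of r T12] assms by (cases "t = r") simp_all
  show ?thesis
  proof (rule graded_span_submodule)
    fix v t assume "v \<in> range f"
    then obtain r where v: "v = f r" by auto
    show "RR t v \<in> span (range f') \<and> XX t v \<in> span {b (nxt t), d (nxt t)} \<and> YY t v \<in> span {b (nxt t), d (nxt t)}"
      unfolding v using transposition_cases[of t r]
      by (auto simp: sigma_RR_f sigma_XX_f sigma_YY_f
          intro!: span_neg span_diff span_zero intro: span_base)
  next
    fix v t assume "v \<in> range f'"
    then obtain r where v: "v = f' r" by auto
    show "RR t v \<in> span (range f) \<and> XX t v \<in> span {b (prv t), d (prv t)} \<and> YY t v \<in> span {b (prv t), d (prv t)}"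
      unfolding v using transposition_cases[of t r]
      by (auto simp: sigma_RR_f sigma_XX_f' sigma_YY_f
          intro!: span_neg span_diff span_zero intro: span_base)
  qed (auto simp: sigmaD(2) sigma_RR_d xb xd yb sigma_YY_d
      intro!: span_neg span_zero intro: span_base)
qed

lemma sigma_mem: "b r \<in> sigma_span"
  by (rule mem_graded_span[OF sigmaD(1)]) (simp add: span_base)

lemma sigma_rot:
  assumes "v \<in> span (range f)"
  shows "v + dgen (Grp rot) \<cdot> v + dgen (Grp rot) \<cdot> dgen (Grp rot) \<cdot> v = 0"
  using assms
proof (induction rule: span_induct_alt)
  case (step c x y)
  then obtain r where x: "x = f r" by auto
  have c: "dgen (Grp rot) \<cdot> f r = f (nxt r)" for r
    by (cases r) (simp_all add: RR_cycle(1)[of T12, symmetric] sigma_RR_f reflect_def)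
  have "x + dgen (Grp rot) \<cdot> x + dgen (Grp rot) \<cdot> dgen (Grp rot) \<cdot> x = 0"
    unfolding x c using sum(1)[of r] by (simp add: algebra_simps)
  then have "c *s (x + dgen (Grp rot) \<cdot> x + dgen (Grp rot) \<cdot> dgen (Grp rot) \<cdot> x)
     + (y + dgen (Grp rot) \<cdot> y + dgen (Grp rot) \<cdot> dgen (Grp rot) \<cdot> y) = 0"
    using step by simp
  then show ?case by (simp only: act_linear scale_right_distrib ac_simps)
qed simp

lemma sigma_odd_type:
  assumes "sigma_span = UNIV" shows odd_type
proof -
  have comp: "v \<in> component {} (range f) (range f') (\<lambda>r. {b r, d r}) g" if "has_degree g v" for g v
    using graded_span_component[of v] assms that unfolding has_degree_def by (metis UNIV_I)
  show ?thesis unfolding odd_type_def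
  proof (intro conjI allI impI)
    fix r v assume "has_degree (perm_of r) v"
    from comp[OF this] have "v \<in> span {b r, d r}" by simp
    then show "RR r v = - v"
      by (rule span_pairE) (simp add: act_linear sigmaD sigma_RR_d)
  next
    fix v assume "has_degree 1 v"
    from comp[OF this] show "v = 0" by simp
  next
    fix v assume "has_degree rot v"
    from comp[OF this] show "v + dgen (Grp rot) \<cdot> v + dgen (Grp rot) \<cdot> dgen (Grp rot) \<cdot> v = 0"
      using sigma_rot by simp
  qed
qed

text \<open>
  Two \<open>y\<close>'s map \<open>d\<^sub>r\<close> to a \<open>b\<close> and kill \<open>b\<^sub>r\<close>; on the degree \<open>(123)\<close> the operators \<open>y\<close> with indices \<open>(12)\<close> and \<open>(23)\<close>
  read off the two coordinates with respect to the basis \<open>f\<^sub>r\<close>, \<open>r = (12), (23)\<close>.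
\<close>

lemma sigma_simple:
  assumes U: "D_submodule U" "U \<subseteq> sigma_span" "U \<noteq> {0}"
  shows "b q \<in> U"
proof -
  have sub: "subspace U" and act: "\<And>d u. u \<in> U \<Longrightarrow> d \<cdot> u \<in> U"
    using U by (auto simp: D_submodule_def)
  have all: "b q \<in> U" if "b r \<in> U" for r
  proof -
    obtain t where "reflect t r = q" using transposition_cases[of q r] reflect_simps by metis
    then show ?thesis
      using act[OF that, of "dgen (Grp (perm_of t))"] subspace_neg[OF sub, of "- b q"]
      by (auto simp: sigmaD(2))
  qed
  have rot: "b q \<in> U" if v: "v \<in> U" "v \<noteq> 0" "has_degree rot v" and sp: "v \<in> span (range f)" for v
  proof -
    have "f T13 = - f T12 - f T23" using sum3_eq_0D[OF sum(1)[of T12]] by simp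
    then have "f r \<in> span {f T12, f T23}" for r
      by (cases r) (simp_all add: span_base span_neg span_diff)
    then have "range f \<subseteq> span {f T12, f T23}" by auto
    then have "v \<in> span {f T12, f T23}" using sp span_minimal[OF _ subspace_span] by blast
    then obtain p p' where v_eq: "v = p *s f T12 + p' *s f T23" by (rule span_pairE)
    have "YY T12 v = p *s b T23" "YY T23 v = (p' - p) *s b T13"
      by (simp_all add: v_eq act_linear sigma_YY_f reflect_def algebra_simps)
    then have "p *s b T23 \<in> U" "(p' - p) *s b T13 \<in> U"
      using act[OF v(1), of "dgen (Y T12)"] act[OF v(1), of "dgen (Y T23)"] by simp_all
    then have *: "p \<noteq> 0 \<Longrightarrow> b T23 \<in> U" "p' - p \<noteq> 0 \<Longrightarrow> b T13 \<in> U"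
      using mem_scaled[OF sub] by blast+
    show ?thesis
    proof (cases "p = 0")
      case True
      then have "p' - p \<noteq> 0" using v(2) v_eq by auto
      then show ?thesis using *(2) all by blast
    next
      case False
      then show ?thesis using *(1) all by blast
    qed
  qed
  obtain g v where v: "v \<in> U" "v \<noteq> 0" "has_degree g v" using submodule_homogeneous[OF U(1,3)] .
  have comp: "v \<in> component {} (range f) (range f') (\<lambda>r. {b r, d r}) g"
    using DD_component[OF U(2) v(1,3)] .
  consider "g = 1" | "g = rot" | "g = rot'" | r where "g = perm_of r"
    using S3_exhaust[of g] by metis
  then show ?thesis
  proof cases
    case 1 then show ?thesis using comp v by simp
  next
    case 2 then show ?thesis using comp v rot by simp
  next
    case 3
    have "RR T12 v \<in> span (range f)"
      using comp 3 by (auto simp: sigma_RR_f intro: span_base elim!: act_span)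
    moreover have "RR T12 v \<noteq> 0" using v(2) by (metis RR_RR act_zero_right)
    ultimately show ?thesis using rot[of "RR T12 v"] act[OF v(1)] deg_RR_shift(3) v(3) 3 by blast
  next
    case 4
    then obtain p p' where v_eq: "v = p *s b r + p' *s d r"
      using comp by (auto elim: span_pairE)
    have "YY (nxt r) (YY (prv r) v) = - (p' *s b (prv r))"
      by (simp add: v_eq act_linear yb sigma_YY_d sigma_YY_f)
    then have "- (p' *s b (prv r)) \<in> U"
      using act[OF act[OF v(1)], of "dgen (Y (nxt r))" "dgen (Y (prv r))"] by simp
    from subspace_neg[OF sub this] have *: "p' *s b (prv r) \<in> U" by simp
    show ?thesis
    proof (cases "p' = 0")
      case True
      then have "p *s b r \<in> U" "p \<noteq> 0" using v(1,2) v_eq by auto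
      then show ?thesis using mem_scaled[OF sub] all by blast
    next
      case False
      then show ?thesis using mem_scaled[OF sub *] all by blast
    qed
  qed
qed

end
end


section \<open>Producing copies of the weights\<close>

text \<open>
  The only possible family with value \<open>a\<close> at \<open>(12)\<close> on which \<open>S\<^sub>3\<close> acts by conjugation of the index and the sign.
\<close>

definition sign_extend :: "'v \<Rightarrow> transposition \<Rightarrow> 'v" where
  "sign_extend a r = (case r of T12 \<Rightarrow> a | T13 \<Rightarrow> - RR T23 a | T23 \<Rightarrow> - RR T13 a)"

lemma sign_extend_T12 [simp]: "sign_extend a T12 = a"
  by (simp add: sign_extend_def)

lemma RR_rot: "RR t (dgen (Grp rot) \<cdot> v) = RR (nxt t) v" "RR t (dgen (Grp rot') \<cdot> v) = RR (prv t) v"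
  by (simp_all add: RR_mult perm_of_mult_rot)

lemma rot_cubed: "dgen (Grp rot) \<cdot> dgen (Grp rot) \<cdot> dgen (Grp rot) \<cdot> v = v"
proof -
  have "dgen (Grp rot) \<cdot> w = RR T12 (RR T23 w)" for w by (simp add: RR_cycle(1)[of T12, symmetric])
  then have "dgen (Grp rot) \<cdot> dgen (Grp rot) \<cdot> dgen (Grp rot) \<cdot> v = RR T12 (RR T23 (dgen (Grp rot) \<cdot> dgen (Grp rot) \<cdot> v))" .
  also have "\<dots> = RR T12 (RR T13 (dgen (Grp rot) \<cdot> v))" by (simp add: RR_rot)
  also have "\<dots> = v" by (simp add: RR_rot)
  finally show ?thesis .
qed

lemma RR_sign_extend:
  assumes "RR T12 a = - a"
  shows "RR t (sign_extend a r) = - sign_extend a (reflect t r)"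
proof -
  have c: "dgen (Grp rot) \<cdot> a = - RR T13 a" "dgen (Grp rot') \<cdot> a = - RR T23 a"
    using RR_cycle[of T13 a] RR_cycle[of T23 a] assms by simp_all
  have "RR T12 (RR T23 a) = - RR T13 a" "RR T13 (RR T23 a) = - RR T23 a"
    "RR T12 (RR T13 a) = - RR T23 a" "RR T23 (RR T13 a) = - RR T13 a"
    using RR_cycle(1)[of T12 a] RR_cycle(2)[of T13 a] RR_cycle(2)[of T12 a] RR_cycle(1)[of T23 a] c by simp_all
  then show ?thesis
    by (cases t; cases r) (simp_all add: sign_extend_def reflect_def assms)
qed

lemma span_fixed_line:
  assumes "\<And>t. RR t w = e *s w" shows "S3_stable (span {w})"
proof -
  have "RR t u \<in> span {w}" if "u \<in> span {w}" for t u
    using that by (auto simp: span_singleton act_scale assms)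
  then show ?thesis unfolding S3_stable_def using Grp_closed by auto
qed

lemma dim_line: "w \<noteq> 0 \<Longrightarrow> dim (span {w}) = 1"
  using dim_span_eq_card_independent[of "{w}"] by simp

text \<open>
  By irreducibility \<open>W\<close> contains no stable line.  So some transposition moves some vector, and after conjugation
  the difference is a nonzero \<open>a\<close> on which \<open>(12)\<close> acts by \<open>-1\<close>.  The sum of the family generated by \<open>a\<close> transforms
  by the sign character, so it would span a stable line unless it is zero.
\<close>

lemma iso_rho_family:
  assumes "iso_rho W"
  obtains k where "rho_family k" "k T12 \<noteq> 0" "\<And>r. k r \<in> W"
proof -
  from assms have stab: "S3_stable W" and dim: "dim W = 2" and deg: "\<And>w. w \<in> W \<Longrightarrow> has_degree 1 w"
    and irr: "\<And>U. S3_stable U \<Longrightarrow> U \<subseteq> W \<Longrightarrow> U = {0} \<or> U = W"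
    by (auto simp: iso_rho_def)
  have sub: "subspace W" and RR_W: "\<And>t w. w \<in> W \<Longrightarrow> RR t w \<in> W"
    using stab by (auto simp: S3_stable_def)
  have no_line: "w = 0" if "w \<in> W" "\<And>t. RR t w = e *s w" for w e
  proof (rule ccontr)
    assume "w \<noteq> 0"
    have "span {w} \<subseteq> W" using that(1) sub by (simp add: span_minimal)
    moreover have "w \<in> span {w}" by (simp add: span_base)
    ultimately have "span {w} = W" using irr[OF span_fixed_line[OF that(2)]] \<open>w \<noteq> 0\<close> by auto
    then show False using dim_line[OF \<open>w \<noteq> 0\<close>] dim by simp
  qed
  have "W \<noteq> {0}"
  proof
    assume "W = {0}"
    then have "dim W = card ({} :: 'v set)" using dim_span_eq_card_independent[of "{}"] independent_empty by simp
    with dim show False by simp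
  qed
  then obtain w where "w \<in> W" "w \<noteq> 0" using subspace_0[OF sub] by blast
  then obtain t where t: "RR t w \<noteq> w" using no_line[of w 1] by auto
  obtain q where q: "reflect q t = T12" using transposition_cases[of T12 t] reflect_simps by metis
  define a where "a = RR q (w - RR t w)"
  have "RR T12 a = RR q (RR t (w - RR t w))"
    unfolding a_def RR_braid[of q t] q ..
  then have a: "RR T12 a = - a" by (simp add: a_def act_linear)
  have aW: "a \<in> W" using \<open>w \<in> W\<close> sub RR_W by (simp add: a_def subspace_diff)
  have "RR q a \<noteq> 0" using t by (simp add: a_def)
  then have "a \<noteq> 0" by auto
  have K: "sign_extend a r \<in> W" for r
    using aW sub RR_W by (cases r) (simp_all add: sign_extend_def subspace_neg)
  have "sign_extend a T12 + sign_extend a T13 + sign_extend a T23 = 0"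
  proof (rule no_line[of _ "- 1"])
    show "sign_extend a T12 + sign_extend a T13 + sign_extend a T23 \<in> W"
      using K sub subspace_add by metis
    show "RR t (sign_extend a T12 + sign_extend a T13 + sign_extend a T23)
       = - 1 *s (sign_extend a T12 + sign_extend a T13 + sign_extend a T23)" for t
      by (cases t) (simp_all add: act_linear RR_sign_extend[OF a] reflect_def del: sign_extend_T12)
  qed
  then have "rho_family (sign_extend a)"
    using deg[OF K] RR_sign_extend[OF a] by (simp add: rho_family_def)
  then show thesis using that \<open>a \<noteq> 0\<close> K by simp
qed

lemma submodule_line:
  assumes "has_degree 1 v" "\<And>t. RR t v = v" "\<And>t. XX t v = 0" "\<And>t. YY t v = 0"
  shows "D_submodule (span {v})"
proof (rule D_submoduleI)
  fix t g u assume "u \<in> span {v}"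
  then obtain c where u: "u = c *s v" by (auto simp: span_singleton)
  show "RR t u \<in> span {v}" "DD g u \<in> span {v}" "XX t u \<in> span {v}" "YY t u \<in> span {v}"
    by (simp_all add: u act_scale assms DD_deg[OF assms(1)] span_base span_scale span_zero)
qed simp


section \<open>Correcting lifted weights to highest weights\<close>

lemma even_antisym_zero:
  assumes even_type "has_degree (perm_of r) v" "RR r v = - v"
  shows "v = 0"
  using even_typeD(1)[OF assms(1,2)] assms(3) double_eq_0[of v] by (metis add.right_inverse)

lemma even_tau_pair:
  assumes even_type "has_degree rot u"
  shows "tau_pair u (RR T12 u)"
proof -
  have *: "RR t (RR (nxt t) u) = u" for t
    using even_typeD(3)[OF assms] by (simp add: RR_cycle(1))
  have "RR (nxt t) u = RR t u" for t using RR_RR[of t "RR (nxt t) u"] * by simp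
  from this[of T12] this[of T23] have "RR t u = RR T12 u" for t by (cases t) simp_all
  moreover have "RR t (RR T12 u) = u" for t using calculation[of t] RR_RR[of t u] by simp
  ultimately show ?thesis using assms(2) deg_RR_shift(2) by (simp add: tau_pair_def)
qed

text \<open>
  The difference of the two sides has degree \<open>r\<close> and changes its sign under \<open>r\<close>, so it lies in a copy of \<open>(\<sigma>,-)\<close>.
\<close>

lemma even_rho_XY:
  assumes even_type "rho_family k" "z \<in> {X, Y}"
  shows "dgen (z r) \<cdot> k (nxt r) = dgen (z r) \<cdot> k (prv r)"
proof -
  let ?v = "dgen (z r) \<cdot> (k (nxt r) - k (prv r))"
  have "has_degree (perm_of r) ?v"
    using assms(3) rho_familyD(1)[OF assms(2)] by (auto intro!: deg_shift deg_linear)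
  moreover have "RR r ?v = - ?v"
    using assms(3) by (simp add: RR_XY act_linear rho_familyD(2)[OF assms(2)])
  ultimately have "?v = 0" using even_antisym_zero[OF assms(1)] by blast
  then show ?thesis by (simp add: act_linear)
qed

lemma even_rho_familyI:
  assumes even_type "\<And>r. has_degree 1 (k r)" "\<And>t r. RR t (k r) = - k (reflect t r)"
  shows "rho_family k"
proof -
  let ?v = "k T12 + k T13 + k T23"
  have "has_degree 1 ?v" by (intro deg_linear assms(2))
  moreover have "RR t ?v = - ?v" for t by (cases t) (simp_all add: act_linear assms(3) reflect_def)
  ultimately have "?v = 0" by (rule even_typeD(2)[OF assms(1)])
  then show ?thesis using assms(2,3) by (simp add: rho_family_def)
qed

text \<open>
  Since \<open>y\<^sub>r\<^sup>2 = 0\<close>, the operator \<open>y\<^sub>r\<close> kills \<open>k'\<^sub>r\<close>.  It takes the same value on the other two \<open>k'\<^sub>q\<close>, and the sum of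
  all three vectors is zero, so it kills these as well.
\<close>

lemma even_rho_correct:
  assumes even: even_type and k: "rho_family k"
  defines "k' \<equiv> \<lambda>r. YY r (XX r (k r))"
  shows "rho_family k'" "YY t (k' r) = 0" "XX r (k' (nxt r)) = XX r (k' (prv r))"
proof -
  have deg: "has_degree 1 (k' r)" for r
    using deg_YY_shift(4)[OF deg_XX_shift(1)[OF rho_familyD(1)[OF k]], of r r r] by (simp add: k'_def)
  show k': "rho_family k'"
    by (rule even_rho_familyI[OF even deg]) (simp add: k'_def RR_YY RR_XX rho_familyD(2)[OF k])
  show "XX r (k' (nxt r)) = XX r (k' (prv r))" using even_rho_XY[OF even k', of X] by simp
  have eq: "YY t (k' (nxt t)) = YY t (k' (prv t))" for t using even_rho_XY[OF even k', of Y] by simp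
  have 0: "YY t (k' t) = 0" by (simp add: k'_def)
  have "YY t (k' t + k' (nxt t) + k' (prv t)) = 0" using rho_familyD(3)[OF k', of t] by simp
  then have "YY t (k' (prv t)) + YY t (k' (prv t)) = 0" using 0 eq[of t] by (simp add: act_add_right)
  then have "YY t (k' (prv t)) = 0" by (rule double_eq_0)
  then show "YY t (k' r) = 0" using 0 eq[of t] transposition_cases[of r t] by auto
qed

text \<open>
  The vectors \<open>y\<^sub>t x\<^sub>t u\<close> are permuted by \<open>(123)\<close>, which acts trivially on degree \<open>(123)\<close> in the absence of \<open>(\<tau>,1)\<close> and
  \<open>(\<tau>,2)\<close>.  So they coincide, and their common value is killed by every \<open>y\<^sub>t\<close> because \<open>y\<^sub>t\<^sup>2 = 0\<close>.
\<close>

lemma even_tau_correct: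
  assumes even: even_type and u: "has_degree rot u"
  defines "u' \<equiv> YY T12 (XX T12 u)"
  obtains w' where "tau_pair u' w'" "\<And>t. YY t u' = 0" "\<And>t. YY t w' = 0" "\<And>r. XX r u' = - XX (prv r) w'"
proof -
  obtain w where "tau_pair u w" using even_tau_pair[OF even u] by blast
  then have Ru: "RR t u = w" "RR t w = u" for t by (auto simp: tau_pair_def)
  have deg: "has_degree rot (YY t (XX t u))" for t
    using deg_YY_shift(4)[OF deg_XX_shift(2)[OF u], of t t] by simp
  have "YY t (XX t u) = dgen (Grp rot) \<cdot> YY t (XX t u)" for t
    using even_typeD(3)[OF even deg] by simp
  also have "dgen (Grp rot) \<cdot> YY t (XX t u) = YY (nxt t) (XX (nxt t) u)" for t
    unfolding RR_cycle(1)[of "prv t", symmetric]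
    by (simp add: RR_YY RR_XX Ru)
  finally have step: "YY t (XX t u) = YY (nxt t) (XX (nxt t) u)" for t .
  from step[of T12] step[of T23] have u': "u' = YY t (XX t u)" for t by (cases t) (simp_all add: u'_def)
  obtain w' where tau': "tau_pair u' w'" using even_tau_pair[OF even deg[of T12]] unfolding u'_def by blast
  then have R': "RR t u' = w'" "RR t w' = u'" and deg': "has_degree rot u'" for t
    by (auto simp: tau_pair_def)
  have y: "YY t u' = 0" for t using u'[of t] by simp
  have "YY t w' = 0" for t using RR_YY[of T12 "reflect T12 t" u'] by (cases t) (simp_all add: R' y reflect_def)
  moreover have "XX r u' = - XX (prv r) w'" for r
  proof -
    have "RR (nxt r) (XX r u') = XX r u'"
      by (rule even_typeD(1)[OF even deg_XX_shift(2)[OF deg']])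
    then show ?thesis by (simp add: RR_XX R')
  qed
  ultimately show thesis using that tau' y by blast
qed

text \<open>
  In the absence of \<open>(\<sigma>,+)\<close> the vector \<open>y\<^sub>t x\<^sub>t b\<^sub>r\<close> is the same for both \<open>t \<noteq> r\<close>, so both \<open>y\<^sub>t\<close> kill it by \<open>y\<^sub>t\<^sup>2 = 0\<close>;
  the third \<open>y\<^sub>r\<close> maps it into degree \<open>e\<close>, which is zero.
\<close>

lemma odd_sigma_correct:
  assumes odd: odd_type and b: "sigma_family b"
  defines "b' \<equiv> \<lambda>r. YY (prv r) (XX (prv r) (b r))"
  shows "sigma_family b'" "YY t (b' r) = 0"
proof -
  have deg: "has_degree (perm_of r) (b' r)" for r
    using deg_YY_shift(2)[OF deg_XX_shift(4)[OF sigma_familyD(1)[OF b, of r], of "prv r", simplified], of "prv r"]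
    by (simp add: b'_def)
  have "RR r (b' r) = - b' r" for r by (rule odd_typeD(1)[OF odd deg])
  then have b'': "b' r = YY (nxt r) (XX (nxt r) (b r))" for r
    by (simp add: b'_def RR_YY RR_XX sigma_familyD(2)[OF b])
  have "RR t (b' r) = - b' (reflect t r)" for t r
    unfolding b''[of "reflect t r"] by (simp add: b'_def RR_YY RR_XX sigma_familyD(2)[OF b])
  then show "sigma_family b'" using deg by (simp add: sigma_family_def)
  have "YY r (b' r) = 0" for r
    using odd_typeD(2)[OF odd] deg_YY_shift(4)[OF deg[of r], of r] by simp
  moreover have "YY (prv r) (b' r) = 0" for r by (simp add: b'_def)
  moreover have "YY (nxt r) (b' r) = 0" for r by (simp add: b'')
  ultimately show "YY t (b' r) = 0" using transposition_cases[of t r] by auto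
qed

text \<open>
  In a module of odd type the vectors that have to vanish for the explicit copy of \<open>L(\<sigma>,-)\<close> would lie in copies of
  weights that do not occur.
\<close>

lemma odd_sigma_relations:
  assumes odd: odd_type and b: "sigma_family b"
  shows "XX r (b r) = 0"
    "XX r (b (nxt r)) + XX (nxt r) (b (prv r)) + XX (prv r) (b r) = 0"
    "XX r (b (prv r)) + XX (nxt r) (b r) + XX (prv r) (b (nxt r)) = 0"
    "XX r (XX (prv r) (XX r (b (nxt r)))) = 0"
proof -
  note zero = odd_typeD(2)[OF odd]
  show "XX r (b r) = 0" using zero deg_XX_shift(4)[OF sigma_familyD(1)[OF b], of r r] by simp
  have deg: "has_degree rot (XX r (b (nxt r)))" for r
    using deg_XX_shift(4)[OF sigma_familyD(1)[OF b], of "nxt r" r] by simp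
  show "XX r (XX (prv r) (XX r (b (nxt r)))) = 0"
    using zero deg_XX_shift(4)[OF deg_XX_shift(2)[OF deg[of r], of "prv r", simplified], of r] by simp
  have c: "dgen (Grp rot) \<cdot> XX r (b q) = XX (nxt r) (b (nxt q))" for r q
    by (cases r; cases q) (simp_all add: RR_cycle(1)[of T12, symmetric] RR_XX sigma_familyD(2)[OF b] reflect_def)
  show 1: "XX r (b (nxt r)) + XX (nxt r) (b (prv r)) + XX (prv r) (b r) = 0" for r
    using odd_typeD(3)[OF odd deg[of r]] by (simp add: c)
  have "RR r (XX r (b (nxt r)) + XX (nxt r) (b (prv r)) + XX (prv r) (b r)) = 0"
    by (simp only: 1 act_zero_right)
  then show "XX r (b (prv r)) + XX (nxt r) (b r) + XX (prv r) (b (nxt r)) = 0"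
    by (simp add: act_add_right RR_XX sigma_familyD(2)[OF b] ac_simps)
qed


section \<open>Types of the simple modules\<close>

lemma simple_submodule_UNIV:
  "simple_D_module \<Longrightarrow> D_submodule N \<Longrightarrow> v \<in> N \<Longrightarrow> v \<noteq> 0 \<Longrightarrow> N = UNIV"
  unfolding simple_D_module_def by blast

lemma lowered_add: "v \<in> lowered \<Longrightarrow> w \<in> lowered \<Longrightarrow> v + w \<in> lowered"
  by (simp add: lowered_def span_add)

text \<open>
  In each of the following four lemmas the vectors by which the explicit module differs from a Verma module are
  singular and of the form \<open>x v\<close>, so they vanish in a simple module, which is therefore the explicit one.
\<close>

lemma simple_trivial_even:
  assumes simp: simple_D_module and v: "trivial_vector v" "v \<noteq> 0" "\<And>t. YY t v = 0"
  shows even_type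
proof -
  have deg: "has_degree 1 v" and RR: "\<And>t. RR t v = v" using v(1) by (auto simp: trivial_vector_def)
  have "XX r v = 0" for r
    by (rule simple_singular[OF simp XX_lowered]) (simp add: cross_deg_1[OF deg] RR v(3))
  then have "span {v} = UNIV"
    using simple_submodule_UNIV[OF simp submodule_line[OF deg RR _ v(3)], of v] v(2) by (simp add: span_base)
  then have all: "\<exists>c. w = c *s v" for w by (metis UNIV_I span_singleton rangeE)
  have 0: "w = 0" if "has_degree g w" "g \<noteq> 1" for g w
    using all[of w] that DD_deg[OF deg, of g] by (auto simp: has_degree_def act_scale)
  show ?thesis unfolding even_type_def
  proof (intro conjI allI impI)
    fix w assume "\<forall>t. RR t w = - w"
    then have "w = - w" using all[of w] RR by (metis act_scale)
    then show "w = 0" using double_eq_0 by (metis add.right_inverse)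
  qed (use 0 in force)+
qed

lemma simple_rho_even:
  assumes simp: simple_D_module and k: "rho_family k" "k T12 \<noteq> 0" "\<And>t r. YY t (k r) = 0"
  shows even_type
proof -
  have xk: "XX r (k (nxt r)) = XX r (k (prv r))" for r
  proof -
    have "XX r (k (nxt r) - k (prv r)) = 0"
      by (rule simple_singular[OF simp XX_lowered])
        (simp add: cross_deg_1 deg_linear rho_familyD[OF k(1)] act_linear k(3))
    then show ?thesis by (simp add: act_linear)
  qed
  show ?thesis
    using rho_even_type[OF k(1,3) xk] simple_submodule_UNIV[OF simp rho_submodule[OF k(1,3) xk] rho_mem[OF k(1,3) xk] k(2)]
    by blast
qed

lemma simple_tau_even:
  assumes simp: simple_D_module and u: "tau_pair u w" "u \<noteq> 0" "\<And>t. YY t u = 0" "\<And>t. YY t w = 0"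
  shows even_type
proof -
  have deg: "has_degree rot u" "has_degree rot' w" and RR: "RR t u = w" "RR t w = u" for t
    using u(1) by (auto simp: tau_pair_def)
  have xu: "XX r u = - XX (prv r) w" for r
  proof -
    have "XX r u + XX (prv r) w = 0"
    proof (rule simple_singular[OF simp])
      show "YY s (XX r u + XX (prv r) w) = 0" for s
        using transposition_cases[of s r]
        by (auto simp: act_linear cross_deg_rot[OF deg(1)] cross_deg_rot'[OF deg(2)] RR u(3,4))
    qed (simp add: lowered_add XX_lowered)
    then show ?thesis by (simp add: eq_neg_iff_add_eq_0)
  qed
  have x: "XX r u = XX (prv (nxt r)) u" "XX r w = - XX (prv (prv r)) u" for r
    using xu[of "nxt r"] by simp_all
  note facts = u(1,3,4) x refl
  show ?thesis
    by (rule tau_even_type[OF facts simple_submodule_UNIV[OF simp tau_submodule[OF facts] tau_mem[OF facts] u(2)]])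
qed

lemma simple_sigma_odd:
  assumes simp: simple_D_module and b: "sigma_family b" "b T12 \<noteq> 0" "\<And>t r. YY t (b r) = 0"
  shows odd_type
proof -
  note sing = sigma_singular[OF b(1,3)]
  have xb: "XX r (b r) = 0" for r
    by (rule simple_singular[OF simp XX_lowered]) (rule sing)
  have sum: "XX r (b (nxt r)) + XX (nxt r) (b (nxt (nxt r))) + XX (prv r) (b (nxt (prv r))) = 0"
    "XX r (b (prv r)) + XX (nxt r) (b (prv (nxt r))) + XX (prv r) (b (prv (prv r))) = 0" for r
    unfolding nxt_prv by (rule simple_singular[OF simp], (simp add: lowered_add XX_lowered), rule sing)+
  note facts = b(1,3) xb refl refl sum refl
  have "XX T12 (XX (prv T12) (XX T12 (b (nxt T12)))) = 0"
    by (rule simple_singular[OF simp XX_lowered]) (rule sigma_singular_cubic[OF facts])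
  from sigma_submodule[OF facts this]
  show ?thesis
    by (intro sigma_odd_type[OF facts] simple_submodule_UNIV[OF simp _ sigma_mem[OF facts] b(2)])
qed

lemma highest_weight_trivial:
  assumes "has_highest_weight \<zeta> E_plus"
  obtains v where "trivial_vector v" "v \<noteq> 0" "\<And>t. YY t v = 0"
proof -
  from assms obtain W v where "v \<noteq> 0" "W = span {v}" "has_degree 1 v" "\<forall>g. dgen (Grp g) \<cdot> v = 1 *s v" "\<forall>r. \<forall>w\<in>W. YY r w = 0"
    by (auto simp: has_highest_weight_def iso_character_def)
  then have "trivial_vector v" "YY t v = 0" for t by (auto simp: trivial_vector_def span_base)
  then show thesis using that \<open>v \<noteq> 0\<close> by blast
qed

lemma highest_weight_rho:
  assumes "has_highest_weight \<zeta> E_rho"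
  obtains k where "rho_family k" "k T12 \<noteq> 0" "\<And>t r. YY t (k r) = 0"
proof -
  from assms obtain W where W: "iso_rho W" "\<forall>r. \<forall>w\<in>W. YY r w = 0"
    by (auto simp: has_highest_weight_def)
  obtain k where "rho_family k" "k T12 \<noteq> 0" "\<And>r. k r \<in> W" using iso_rho_family[OF W(1)] by blast
  then show thesis using that W(2) by blast
qed

lemma highest_weight_tau:
  assumes "has_highest_weight \<zeta> Tau_0"
  obtains u w where "tau_pair u w" "u \<noteq> 0" "\<And>t. YY t u = 0" "\<And>t. YY t w = 0"
proof -
  from assms obtain W u w where ind: "independent {u, w}" and W: "span {u, w} = W" "\<forall>r. \<forall>w\<in>W. YY r w = 0"
    and deg: "has_degree c123 u" "has_degree c132 w" and R: "RR T12 u = w" "RR T12 w = u"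
    and c: "dgen (Grp c123) \<cdot> u = 1 *s u" "dgen (Grp c123) \<cdot> w = inverse 1 *s w"
    unfolding has_highest_weight_def iso_weight.simps iso_tau_def by blast
  have c: "RR t (RR (nxt t) u) = u" "RR t (RR (nxt t) w) = w" for t
    using c unfolding c123_eq by (simp_all add: RR_cycle(1))
  have Ru: "RR (nxt t) u = RR t u" "RR (nxt t) w = RR t w" for t
    using RR_RR[of t "RR (nxt t) u"] RR_RR[of t "RR (nxt t) w"] c[of t] by simp_all
  from Ru[of T12] Ru[of T23] R have "RR t u = w \<and> RR t w = u" for t by (cases t) simp_all
  then have "tau_pair u w" using deg unfolding c123_eq c132_eq by (simp add: tau_pair_def)
  moreover have "u \<noteq> 0" using ind dependent_zero[of "{u, w}"] by auto
  moreover have "u \<in> W" "w \<in> W" by (simp_all add: W(1)[symmetric] span_base)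
  ultimately show thesis using that W(2) by blast
qed

lemma highest_weight_sigma:
  assumes "has_highest_weight \<zeta> Sigma_minus"
  obtains b where "sigma_family b" "b T12 \<noteq> 0" "\<And>t r. YY t (b r) = 0"
proof -
  from assms obtain W b where b: "is_basis_of UNIV b W" "\<forall>r. has_degree (perm_of r) (b r)"
    "\<forall>g r. dgen (Grp g) \<cdot> b r = sgn3 g *s b (conjt g r)" and W: "\<forall>r. \<forall>w\<in>W. YY r w = 0"
    unfolding has_highest_weight_def iso_weight.simps iso_sigma_def by blast
  have "sigma_family b" using b(2,3) by (simp add: sigma_family_def sgn3_perm_of conjt_perm_of)
  moreover have "b T12 \<noteq> 0" using b(1) dependent_zero[of "range b"] by (auto simp: is_basis_of_def)
  moreover have "b r \<in> W" for r using b(1) by (auto simp: is_basis_of_def span_base)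
  ultimately show thesis using that W by blast
qed

lemma highest_weight_even_type:
  assumes "simple_D_module" "has_highest_weight \<zeta> mu" "mu \<in> {E_plus, E_rho, Tau_0}"
  shows even_type
proof -
  from assms(3) consider "mu = E_plus" | "mu = E_rho" | "mu = Tau_0" by auto
  then show ?thesis
  proof cases
    case 1 then show ?thesis using assms(1,2) highest_weight_trivial simple_trivial_even by metis
  next
    case 2 then show ?thesis using assms(1,2) highest_weight_rho simple_rho_even by metis
  next
    case 3 then show ?thesis using assms(1,2) highest_weight_tau simple_tau_even by metis
  qed
qed

lemma highest_weight_odd_type:
  assumes "simple_D_module" "has_highest_weight \<zeta> Sigma_minus"
  shows odd_type
  using assms highest_weight_sigma simple_sigma_odd by metis


end


section \<open>Extensions\<close>

locale D_extension =
  M: char0_D_module sM aM + E: char0_D_module sE aE + L: char0_D_module sL aL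
  for sM :: "'k::field_char_0 \<Rightarrow> 'm::ab_group_add \<Rightarrow> 'm" and aM :: "'k double \<Rightarrow> 'm \<Rightarrow> 'm"
    and sE :: "'k \<Rightarrow> 'e::ab_group_add \<Rightarrow> 'e" and aE :: "'k double \<Rightarrow> 'e \<Rightarrow> 'e"
    and sL :: "'k \<Rightarrow> 'l::ab_group_add \<Rightarrow> 'l" and aL :: "'k double \<Rightarrow> 'l \<Rightarrow> 'l" +
  fixes i :: "'m \<Rightarrow> 'e" and p :: "'e \<Rightarrow> 'l"
  assumes exact: "short_exact sM aM sE aE sL aL i p"
begin

sublocale i: Vector_Spaces.linear sM sE i
  using exact by (simp add: short_exact_def D_hom_def)

sublocale p: Vector_Spaces.linear sE sL p
  using exact by (simp add: short_exact_def D_hom_def)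

lemma i_act: "i (aM d m) = aE d (i m)" and p_act: "p (aE d v) = aL d (p v)"
  and inj_i: "inj i" and surj_p: "surj p" and range_i: "range i = {v. p v = 0}"
  using exact by (auto simp: short_exact_def D_hom_def)

lemma kernel: "p v = 0 \<Longrightarrow> \<exists>m. v = i m"
  using range_i by blast

lemma p_i: "p (i m) = 0"
  using range_i by blast

lemma i_eq_iff [simp]: "i m = i n \<longleftrightarrow> m = n"
  using inj_i by (simp add: inj_eq)

lemma i_deg: "E.has_degree g (i m) \<longleftrightarrow> M.has_degree g m"
  by (simp add: E.has_degree_def M.has_degree_def flip: i_act)

lemma p_deg: "E.has_degree g v \<Longrightarrow> L.has_degree g (p v)"
  by (metis E.has_degree_def L.has_degree_def p_act)

lemma lift:
  assumes "L.has_degree g l" obtains v where "E.has_degree g v" "p v = l"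
proof -
  obtain v where "p v = l" using surj_p by (metis surjD)
  then have "p (aE (dgen (Dlt g)) v) = l" using assms by (simp add: p_act L.has_degree_def)
  then show thesis using that E.deg_DD by blast
qed

text \<open>
  On degree \<open>r\<close> the operator \<open>r - 1\<close> maps into the submodule, where \<open>r = 1\<close>; so \<open>(r - 1)\<^sup>2 = 0\<close>, whereas
  \<open>(r - 1)\<^sup>2 = - 2 (r - 1)\<close>.  On degree \<open>(123)\<close> let \<open>c\<close> be the rotation: \<open>(c - 1)\<^sup>2 = 0\<close> and \<open>c\<^sup>3 = 1\<close> give \<open>3 (c - 1) = 0\<close>.
\<close>

lemma even_type:
  assumes M: M.even_type and L: L.even_type shows E.even_type
  unfolding E.even_type_def
proof (intro conjI allI impI)
  fix r v assume v: "E.has_degree (perm_of r) v"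
  have "p (E.RR r v - v) = 0"
    using L.even_typeD(1)[OF L p_deg[OF v]] by (simp add: p.diff p_act)
  then obtain m where m: "E.RR r v - v = i m" using kernel by blast
  have "E.has_degree (perm_of r) (i m)"
    using E.deg_RR_shift(4)[OF v, of r] E.deg_linear(2) v by (simp flip: m)
  then have "E.RR r (i m) = i m" using M.even_typeD(1)[OF M] by (simp add: i_deg flip: i_act)
  then have "(E.RR r v - v) + (E.RR r v - v) = 0" unfolding m[symmetric] by (simp add: E.act_linear algebra_simps)
  then have "E.RR r v - v = 0" by (rule E.double_eq_0)
  then show "E.RR r v = v" by simp
next
  fix v assume v: "E.has_degree 1 v" "\<forall>t. E.RR t v = - v"
  have "L.RR t (p v) = - p v" for t using v(2) by (metis p_act p.neg)
  then have "p v = 0" by (rule L.even_typeD(2)[OF L p_deg[OF v(1)]])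
  then obtain m where m: "v = i m" using kernel by blast
  have "i (M.RR t m) = i (- m)" for t using v(2) by (simp add: m i_act i.neg)
  then have "m = 0" using v(1) by (intro M.even_typeD(2)[OF M]) (simp_all add: m i_deg)
  then show "v = 0" by (simp add: m i.zero)
next
  let ?c = "dgen (Grp rot)"
  fix v assume v: "E.has_degree rot v"
  have "p (aE ?c v - v) = 0"
    using L.even_typeD(3)[OF L p_deg[OF v]] by (simp add: p.diff p_act)
  then obtain m where m: "aE ?c v - v = i m" using kernel by blast
  have "E.has_degree rot (aE ?c v)" using E.deg_RR_shift(2,3) v unfolding E.RR_cycle(1)[of T12, symmetric] by blast
  then have "E.has_degree rot (i m)" using E.deg_linear(2) v by (simp flip: m)
  then have "aE ?c (i m) = i m" using M.even_typeD(3)[OF M] by (simp add: i_deg flip: i_act)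
  then have 1: "aE ?c (aE ?c v) = aE ?c v + aE ?c v - v" unfolding m[symmetric] by (simp add: E.act_linear algebra_simps)
  have "v = aE ?c (aE ?c (aE ?c v))" by (rule E.rot_cubed[symmetric])
  also have "\<dots> = aE ?c v + aE ?c v + aE ?c v - v - v" by (simp add: 1 E.act_linear)
  finally have "(aE ?c v - v) + (aE ?c v - v) + (aE ?c v - v) = 0" by (simp add: algebra_simps)
  then have "aE ?c v - v = 0" by (rule E.triple_eq_0)
  then show "aE ?c v = v" by simp
qed

text \<open>
  As before, with \<open>r + 1\<close> and \<open>1 + c + c\<^sup>2\<close>, whose squares are \<open>2 (r + 1)\<close> and \<open>3 (1 + c + c\<^sup>2)\<close>.
\<close>

lemma odd_type:
  assumes M: M.odd_type and L: L.odd_type shows E.odd_type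
  unfolding E.odd_type_def
proof (intro conjI allI impI)
  fix r v assume v: "E.has_degree (perm_of r) v"
  have "p (E.RR r v + v) = 0"
    using L.odd_typeD(1)[OF L p_deg[OF v]] by (simp add: p.add p_act)
  then obtain m where m: "E.RR r v + v = i m" using kernel by blast
  have "E.has_degree (perm_of r) (i m)"
    using E.deg_RR_shift(4)[OF v, of r] E.deg_linear(1) v by (simp flip: m)
  then have "E.RR r (i m) = - i m" using M.odd_typeD(1)[OF M, of r m] by (simp add: i_deg flip: i_act i.neg)
  then have "(E.RR r v + v) + (E.RR r v + v) = 0" unfolding m[symmetric] by (simp add: E.act_linear algebra_simps)
  then have "E.RR r v + v = 0" by (rule E.double_eq_0)
  then show "E.RR r v = - v" by (simp add: eq_neg_iff_add_eq_0)
next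
  fix v assume v: "E.has_degree 1 v"
  have "p v = 0" by (rule L.odd_typeD(2)[OF L p_deg[OF v]])
  then obtain m where m: "v = i m" using kernel by blast
  then have "m = 0" using v by (intro M.odd_typeD(2)[OF M]) (simp add: i_deg)
  then show "v = 0" by (simp add: m i.zero)
next
  let ?c = "dgen (Grp rot)"
  fix v assume v: "E.has_degree rot v"
  define w where "w = v + aE ?c v + aE ?c (aE ?c v)"
  have "p w = 0"
    using L.odd_typeD(3)[OF L p_deg[OF v]] by (simp add: w_def p.add p_act)
  then obtain m where m: "w = i m" using kernel by blast
  have deg: "E.has_degree rot (aE ?c v)" if "E.has_degree rot v" for v
    using E.deg_RR_shift(2,3) that unfolding E.RR_cycle(1)[of T12, symmetric] by blast
  have "E.has_degree rot w" using v deg by (simp add: w_def E.deg_linear)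
  then have "M.has_degree rot m" by (simp add: m i_deg)
  then have "m + aM ?c m + aM ?c (aM ?c m) = 0" by (rule M.odd_typeD(3)[OF M])
  then have "i (m + aM ?c m + aM ?c (aM ?c m)) = 0" by (simp add: i.zero)
  then have "w + aE ?c w + aE ?c (aE ?c w) = 0" by (simp add: m i.add i_act)
  moreover have "aE ?c w = w" by (simp add: w_def E.act_linear E.rot_cubed ac_simps)
  ultimately have "w + w + w = 0" by simp
  then have "w = 0" by (rule E.triple_eq_0)
  then show "v + aE ?c v + aE ?c (aE ?c v) = 0" by (simp only: w_def)
qed

text \<open>
  The projection \<open>p\<close> restricts to an isomorphism from \<open>N\<close> to the quotient; its inverse \<open>q\<close> is a section of \<open>p\<close>.
\<close>

lemma split_complement:
  assumes N: "E.D_submodule N" and ker: "\<And>v. v \<in> N \<Longrightarrow> p v = 0 \<Longrightarrow> v = 0"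
    and nonzero: "v \<in> N" "p v \<noteq> 0" and simple: L.simple_D_module
  shows "D_isomorphic sE aE (sum_scale sM sL) (sum_act aM aL)"
proof -
  have sub: "E.subspace N" and act: "\<And>d v. v \<in> N \<Longrightarrow> aE d v \<in> N"
    using N by (auto simp: E.D_submodule_def)
  have "L.D_submodule (p ` N)"
    unfolding L.D_submodule_def using p.subspace_image[OF sub] act by (auto simp flip: p_act)
  then have onto: "p ` N = UNIV"
    using L.simple_submodule_UNIV[OF simple, of "p ` N" "p v"] nonzero by blast
  define q where "q l = (SOME n. n \<in> N \<and> p n = l)" for l
  have q: "q l \<in> N" "p (q l) = l" for l
  proof -
    have "l \<in> p ` N" using onto by simp
    then have "\<exists>n. n \<in> N \<and> p n = l" by blast
    then show "q l \<in> N" "p (q l) = l" unfolding q_def by (metis (mono_tags, lifting) someI_ex)+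
  qed
  have unique: "n = q l" if "n \<in> N" "p n = l" for n l
    using ker[of "n - q l"] that q sub by (simp add: E.subspace_diff p.diff)
  have q_add: "q (l + l') = q l + q l'" and q_scale: "q (sL c l) = sE c (q l)"
    and q_act: "q (aL d l) = aE d (q l)" for l l' c d
    by (rule unique[symmetric]; simp add: q sub E.subspace_add E.subspace_scale act p.add p.scale p_act)+
  define f where "f v = (inv i (v - q (p v)), p v)" for v
  have i_inv: "i (inv i (v - q (p v))) = v - q (p v)" for v
    using range_i q by (intro f_inv_into_f) (simp add: p.diff)
  have f_eqI: "f v = (m, l)" if "i m + q l = v" for m l v
  proof -
    have l: "p v = l" using that[symmetric] by (simp add: p.add p_i q)
    have "i (inv i (v - q (p v))) = v - q l" using i_inv[of v] l by simp
    also have "\<dots> = i m" using that by (simp add: diff_eq_eq)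
    finally show ?thesis by (simp add: f_def l)
  qed
  have f_inv: "i (fst (f v)) + q (snd (f v)) = v" for v by (simp add: f_def i_inv)
  interpret MxL: vector_space_prod sM sL ..
  have "bij f"
  proof (rule bijI)
    show "inj f" by (metis f_inv injI)
    show "surj f" by (metis f_eqI surj_def surj_pair)
  qed
  moreover have "D_hom sE aE (sum_scale sM sL) (sum_act aM aL) f"
    unfolding D_hom_def
  proof (intro conjI allI)
    show "Vector_Spaces.linear sE (sum_scale sM sL) f"
      unfolding sum_scale_def
    proof (unfold_locales)
      show "f (v + w) = f v + f w" for v w
        using f_inv[of v] f_inv[of w] by (cases "f v"; cases "f w")
          (auto simp: i.add q_add algebra_simps intro!: f_eqI)
      show "f (sE c v) = MxL.scale c (f v)" for c v
        using f_inv[of v, THEN arg_cong[of _ _ "sE c"]] by (cases "f v")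
          (auto simp: MxL.scale_def i.scale q_scale E.scale_right_distrib intro!: f_eqI)
    qed
    show "f (aE d v) = sum_act aM aL d (f v)" for d v
      using f_inv[of v, THEN arg_cong[of _ _ "aE d"]] by (cases "f v")
        (auto simp: sum_act_def i_act q_act E.act_add_right intro!: f_eqI)
  qed
  ultimately show ?thesis unfolding D_isomorphic_def by blast
qed

text \<open>
  The intersection of \<open>N\<close> with the kernel of \<open>p\<close> is a submodule of \<open>N\<close> that does not contain \<open>v\<close>.
\<close>

lemma split_by_simplicity:
  assumes N: "E.D_submodule N" "v \<in> N" "p v \<noteq> 0"
    and simple: "\<And>U. E.D_submodule U \<Longrightarrow> U \<subseteq> N \<Longrightarrow> U \<noteq> {0} \<Longrightarrow> v \<in> U"
    and L: L.simple_D_module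
  shows "D_isomorphic sE aE (sum_scale sM sL) (sum_act aM aL)"
proof (rule split_complement[OF N(1) _ N(2,3) L])
  fix w assume w: "w \<in> N" "p w = 0"
  define U where "U = {v \<in> N. p v = 0}"
  have "E.D_submodule U"
    using N(1) unfolding E.D_submodule_def E.subspace_def U_def
    by (auto simp: p.add p.scale p.zero p_act)
  moreover have "v \<notin> U" using N(3) by (simp add: U_def)
  ultimately have "U = {0}" using simple[of U] by (auto simp: U_def)
  then show "w = 0" using w by (auto simp: U_def)
qed

text \<open>
  The lift of the top vector is averaged over \<open>S\<^sub>3\<close>.  Its images under \<open>x\<^sub>r\<close> and \<open>y\<^sub>r\<close> transform by \<open>-1\<close> under \<open>r\<close> and
  vanish, because \<open>(\<sigma>,-)\<close> does not occur; so it spans a trivial submodule.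
\<close>

lemma split_trivial:
  assumes L: L.simple_D_module and even: E.even_type
    and l: "L.trivial_vector l" "l \<noteq> 0"
  shows "D_isomorphic sE aE (sum_scale sM sL) (sum_act aM aL)"
proof -
  have Rl: "L.RR t l = l" for t using l(1) by (simp add: L.trivial_vector_def)
  obtain v where v: "E.has_degree 1 v" "p v = l"
    using lift l(1) unfolding L.trivial_vector_def by blast
  (* six times the average: the sum of the translates of v under the six elements of the group *)
  define a where "a = (v + E.RR T12 v) + (aE (dgen (Grp rot)) v + E.RR T23 v) + (aE (dgen (Grp rot')) v + E.RR T13 v)"
  have R: "E.RR t (aE (dgen (Grp rot)) v) = E.RR (nxt t) v" "E.RR t (aE (dgen (Grp rot')) v) = E.RR (prv t) v" for t
    by (rule E.RR_rot)+
  have R2: "E.RR T12 (E.RR T23 v) = aE (dgen (Grp rot)) v" "E.RR T23 (E.RR T13 v) = aE (dgen (Grp rot)) v"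
     "E.RR T13 (E.RR T12 v) = aE (dgen (Grp rot)) v" "E.RR T12 (E.RR T13 v) = aE (dgen (Grp rot')) v"
     "E.RR T13 (E.RR T23 v) = aE (dgen (Grp rot')) v" "E.RR T23 (E.RR T12 v) = aE (dgen (Grp rot')) v"
    using E.RR_cycle(1)[of T12 v] E.RR_cycle(1)[of T23 v] E.RR_cycle(1)[of T13 v]
      E.RR_cycle(2)[of T12 v] E.RR_cycle(2)[of T23 v] E.RR_cycle(2)[of T13 v] by simp_all
  have Ra: "E.RR t a = a" for t
    by (cases t) (simp_all add: a_def E.act_add_right R R2 ac_simps)
  have deg: "E.has_degree 1 a"
    unfolding a_def E.RR_cycle(1)[of T12, symmetric] E.RR_cycle(2)[of T12, symmetric]
    by (intro E.deg_linear E.deg_RR_shift(1) v(1))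
  have "p a = (l + l) + (l + l) + (l + l)"
    unfolding a_def E.RR_cycle(1)[of T12, symmetric] E.RR_cycle(2)[of T12, symmetric]
    by (simp add: p.add p_act v(2) Rl)
  then have pa: "p a \<noteq> 0" using l(2) L.double_eq_0 L.triple_eq_0 by metis
  have XY: "aE (dgen (z r)) a = 0" if "z \<in> {X, Y}" for z r
  proof (rule E.even_antisym_zero[OF even])
    show "E.has_degree (perm_of r) (aE (dgen (z r)) a)"
      using that E.deg_shift(1)[OF deg] E.deg_YY_shift(1)[OF deg] by auto
    show "E.RR r (aE (dgen (z r)) a) = - aE (dgen (z r)) a"
      by (simp add: E.RR_XY[OF that] Ra)
  qed
  show ?thesis
  proof (rule split_by_simplicity[OF _ _ pa _ L])
    show "E.D_submodule (E.span {a})"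
      using XY by (intro E.submodule_line deg Ra) auto
    show "a \<in> E.span {a}" by (simp add: E.span_base)
    fix U assume U: "E.D_submodule U" "U \<subseteq> E.span {a}" "U \<noteq> {0}"
    then obtain g w where "w \<in> U" "w \<noteq> 0" using E.submodule_homogeneous by metis
    moreover from this U(2) obtain c where "w = sE c a" by (auto simp: E.span_singleton)
    ultimately show "a \<in> U" using E.mem_scaled[of U c a] U(1) by (auto simp: E.D_submodule_def)
  qed
qed

lemma p_sign_extend: "p (E.sign_extend a r) = L.sign_extend (p a) r"
  by (cases r) (simp_all add: E.sign_extend_def L.sign_extend_def p.neg p_act)

lemma lift_sign:
  assumes "L.has_degree g l" "L.RR T12 l = - l" "perm_of T12 * g * perm_of T12 = g"
  obtains a where "E.has_degree g a" "E.RR T12 a = - a" "p a = l"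
proof -
  obtain v where v: "E.has_degree g v" "p v = l" using lift[OF assms(1)] .
  let ?a = "sE (1/2) (v - E.RR T12 v)"
  have "p ?a = sL (1/2) (l + l)" using v(2) assms(2) by (simp add: p.scale p.diff p_act)
  also have "\<dots> = l" by (rule L.halve[OF refl, symmetric])
  finally have "p ?a = l" .
  moreover have "E.has_degree g ?a"
    using E.deg_RR[OF v(1), of T12] assms(3) v(1) by (simp add: E.deg_linear)
  moreover have "E.RR T12 ?a = - ?a" by (simp add: E.act_linear flip: E.scale_minus_right)
  ultimately show thesis using that by blast
qed

lemma sign_extend_eq:
  assumes "\<And>t r. L.RR t (k r) = - k (reflect t r)" shows "L.sign_extend (k T12) = k"
proof (rule ext)
  show "L.sign_extend (k T12) r = k r" for r
    by (cases r) (simp_all add: L.sign_extend_def assms reflect_def)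
qed

text \<open>
  On the top of \<open>L(e,\<rho>)\<close> the correction \<open>k\<^sub>r \<mapsto> y\<^sub>r x\<^sub>r k\<^sub>r\<close> is multiplication by \<open>2\<close>, so the corrected lift is not
  mapped to zero.
\<close>

lemma split_rho:
  assumes L: L.simple_D_module and even: E.even_type
    and l: "L.rho_family l" "l T12 \<noteq> 0" "\<And>t r. L.YY t (l r) = 0"
  shows "D_isomorphic sE aE (sum_scale sM sL) (sum_act aM aL)"
proof -
  note lD = L.rho_familyD[OF l(1)]
  obtain a where a: "E.has_degree 1 a" "E.RR T12 a = - a" "p a = l T12"
    using lift_sign[OF lD(1)[of T12]] lD(2)[of T12 T12] by (auto simp: perm_of_square)
  let ?k = "E.sign_extend a"
  have pk: "p (?k r) = l r" for r using sign_extend_eq[OF lD(2)] by (simp add: p_sign_extend a(3))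
  have "E.has_degree 1 (?k r)" for r
    by (cases r) (simp_all add: E.sign_extend_def E.deg_linear E.deg_RR_shift a(1))
  then have k: "E.rho_family ?k" using E.even_rho_familyI[OF even] E.RR_sign_extend[OF a(2)] by blast
  note k' = E.even_rho_correct[OF even k]
  have "p (E.YY T12 (E.XX T12 (?k T12))) = l T12 + l T12"
    by (simp add: p_act pk L.cross_deg_1[OF lD(1)] lD(2) l(3) del: E.sign_extend_T12)
  then have "p (E.YY T12 (E.XX T12 (?k T12))) \<noteq> 0" using l(2) L.double_eq_0 by metis
  with E.rho_submodule[OF k'] E.rho_mem[OF k'] show ?thesis
    by (rule split_by_simplicity[OF _ _ _ _ L]) (rule E.rho_simple[OF k'])
qed

text \<open>
  On the top of \<open>L(\<tau>,0)\<close> the correction is the identity.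
\<close>

lemma split_tau:
  assumes L: L.simple_D_module and even: E.even_type
    and l: "L.tau_pair l l'" "l \<noteq> 0" "\<And>t. L.YY t l = 0"
  shows "D_isomorphic sE aE (sum_scale sM sL) (sum_act aM aL)"
proof -
  have deg: "L.has_degree rot l" using l(1) by (simp add: L.tau_pair_def)
  obtain u where u: "E.has_degree rot u" "p u = l" using lift[OF deg] .
  let ?u = "E.YY T12 (E.XX T12 u)"
  obtain w where w: "E.tau_pair ?u w" "\<And>t. E.YY t ?u = 0" "\<And>t. E.YY t w = 0" "\<And>r. E.XX r ?u = - E.XX (prv r) w"
    using E.even_tau_correct[OF even u(1)] by blast
  have x: "E.XX r ?u = E.XX (prv (nxt r)) ?u" "E.XX r w = - E.XX (prv (prv r)) ?u" for r
    using w(4)[of "nxt r"] by simp_all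
  note facts = w(1-3) x refl
  have "p ?u = l" by (simp add: p_act u(2) L.cross_deg_rot[OF deg] l(3))
  then have "p ?u \<noteq> 0" using l(2) by simp
  with E.tau_submodule[OF facts] E.tau_mem[OF facts] show ?thesis
    by (rule split_by_simplicity[OF _ _ _ _ L]) (rule E.tau_simple[OF facts])
qed

text \<open>
  On the top of \<open>L(\<sigma>,-)\<close> the correction is the identity.
\<close>

lemma split_sigma:
  assumes L: L.simple_D_module and odd: E.odd_type
    and l: "L.sigma_family l" "l T12 \<noteq> 0" "\<And>t r. L.YY t (l r) = 0"
  shows "D_isomorphic sE aE (sum_scale sM sL) (sum_act aM aL)"
proof -
  note lD = L.sigma_familyD[OF l(1)]
  obtain a where a: "E.has_degree (perm_of T12) a" "E.RR T12 a = - a" "p a = l T12"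
    using lift_sign[OF lD(1)[of T12]] lD(2)[of T12 T12] by (auto simp: perm_of_square)
  let ?b = "E.sign_extend a"
  have pb: "p (?b r) = l r" for r using sign_extend_eq[OF lD(2)] by (simp add: p_sign_extend a(3))
  have "E.has_degree (perm_of r) (?b r)" for r
    using a(1) E.deg_RR_shift(4)[OF a(1), of T13] E.deg_RR_shift(4)[OF a(1), of T23]
    by (cases r) (simp_all add: E.sign_extend_def E.deg_linear reflect_def)
  then have b: "E.sigma_family ?b" using E.RR_sign_extend[OF a(2)] by (simp add: E.sigma_family_def)
  note b' = E.odd_sigma_correct[OF odd b]
  note rel = E.odd_sigma_relations[OF odd b'(1)]
  have sum: "E.XX r (b (nxt r)) + E.XX (nxt r) (b (nxt (nxt r))) + E.XX (prv r) (b (nxt (prv r))) = 0"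
    "E.XX r (b (prv r)) + E.XX (nxt r) (b (prv (nxt r))) + E.XX (prv r) (b (prv (prv r))) = 0"
    if "b = (\<lambda>r. E.YY (prv r) (E.XX (prv r) (?b r)))" for r b
    unfolding nxt_prv that using rel(2,3) by simp_all
  note facts = b' rel(1) refl refl sum[OF refl] refl
  have "p (E.YY (prv T12) (E.XX (prv T12) (?b T12))) = l T12"
    by (simp add: p_act pb L.sigma_YY_XX[OF l(1,3)] del: E.sign_extend_T12)
  then have "p (E.YY (prv T12) (E.XX (prv T12) (?b T12))) \<noteq> 0" using l(2) by simp
  with E.sigma_submodule[OF facts rel(4)] E.sigma_mem[OF facts, of T12] show ?thesis
    by (rule split_by_simplicity[OF _ _ _ _ L]) (rule E.sigma_simple[OF facts])
qed

end

theorem lemma3p1: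
  fixes \<zeta> :: "'k::{alg_closed_field, field_char_0}"
    and lam mu :: weight
    and sM :: "'k \<Rightarrow> 'm::ab_group_add \<Rightarrow> 'm" and aM :: "'k double \<Rightarrow> 'm \<Rightarrow> 'm"
    and sE :: "'k \<Rightarrow> 'e::ab_group_add \<Rightarrow> 'e" and aE :: "'k double \<Rightarrow> 'e \<Rightarrow> 'e"
    and sL :: "'k \<Rightarrow> 'l::ab_group_add \<Rightarrow> 'l" and aL :: "'k double \<Rightarrow> 'l \<Rightarrow> 'l"
    and i :: "'m \<Rightarrow> 'e" and p :: "'e \<Rightarrow> 'l"
  assumes "\<zeta> ^ 3 = 1" and "\<zeta> \<noteq> 1"
    and "is_L \<zeta> mu sM aM"
    and "is_L \<zeta> lam sL aL"
    and "D_module sE aE"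
    and "short_exact sM aM sE aE sL aL i p"
    and "(lam \<in> {E_plus, E_rho, Tau_0} \<and> mu \<in> {E_plus, E_rho, Tau_0}) \<or>
         (lam = Sigma_minus \<and> mu = Sigma_minus)"
  shows "D_isomorphic sE aE (sum_scale sM sL) (sum_act aM aL)"
proof -
  interpret D_extension sM aM sE aE sL aL i p
    using assms(3-6) by (intro D_extension.intro char0_D_module.intro D_extension_axioms.intro)
      (auto simp: is_L_def)
  have L: "L.simple_D_module" "L.has_highest_weight \<zeta> lam"
    and M: "M.simple_D_module" "M.has_highest_weight \<zeta> mu"
    using assms(3,4) by (auto simp: is_L_def)
  show ?thesis
  proof (cases "lam = Sigma_minus")
    case True
    then have "mu = Sigma_minus" using assms(7) by auto
    then have "E.odd_type" using odd_type M.highest_weight_odd_type L.highest_weight_odd_type M L True by metis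
    then show ?thesis using L True L.highest_weight_sigma split_sigma by metis
  next
    case False
    then have lam: "lam \<in> {E_plus, E_rho, Tau_0}" and mu: "mu \<in> {E_plus, E_rho, Tau_0}"
      using assms(7) by auto
    have even: "E.even_type" by (rule even_type[OF M.highest_weight_even_type[OF M mu] L.highest_weight_even_type[OF L lam]])
    from lam consider "lam = E_plus" | "lam = E_rho" | "lam = Tau_0" by auto
    then show ?thesis
    proof cases
      case 1 then show ?thesis using L even L.highest_weight_trivial split_trivial by metis
    next
      case 2 then show ?thesis using L even L.highest_weight_rho split_rho by metis
    next
      case 3 then show ?thesis using L even L.highest_weight_tau split_tau by metis
    qed
  qed
qed

end
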